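(* Suppose $p>3$ is a prime and let $M_p$ be the number of Lehmer numbers modulo $p$. Then $$\left|M_p -\frac{p-1}{2}\right| <T_p^2\, p^{\frac{1}{2}} \log^2 p.$$ Moreover, for all such $p$ we have $$\left|M_p -\frac{p-1}{2}\right| <\frac{1}{2}\,p^{\frac{1}{2}} \log^2 p.$$
   Context: Let $p$ be an odd prime. For an integer $a$ with $1\le a\le p-1$, $\bar a$ denotes the integer with $1\le \bar a\le p-1$ that is the inverse of $a$ modulo $p$. The integer $a$ (with $1\le a\le p-1$) is a Lehmer number modulo $p$ if $a$ and $\bar a$ have opposite parity, i.e. $a+\bar a$ is odd. For odd integers $m\ge 3$, $$T_m=\frac{2\sum_{j=1}^{(m-1)/2}\tan\left(\frac{\pi j}{m}\right)}{m\log m}.$$ Here $\log$ is the natural logarithm and $\log^2 p=(\log p)^2$. *)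

theory Defs
  imports Complex_Main "HOL-Number_Theory.Number_Theory"
begin

text \<open>
  For a prime \<open>p\<close> and \<open>1 \<le> a \<le> p - 1\<close>, the library's \<open>modular_inverse\<close> on integers is the
  representative in \<open>{1..p - 1}\<close> of the inverse of \<open>a\<close> modulo \<open>p\<close>.
\<close>
definition lehmer_number :: "nat \<Rightarrow> int \<Rightarrow> bool" where
  "lehmer_number p a \<longleftrightarrow>
     a \<in> {1..int p - 1} \<and> odd (a + modular_inverse (int p) a)"

definition lehmer_count :: "nat \<Rightarrow> nat" where
  "lehmer_count p = card {a. lehmer_number p a}"

text \<open>Only meaningful for odd \<open>m \<ge> 3\<close>, where \<open>(m - 1) div 2\<close> is an exact quotient.\<close>
definition T :: "nat \<Rightarrow> real" where
  "T m = 2 * (\<Sum>j = 1..(m - 1) div 2. tan (pi * real j / real m)) / (real m * ln (real m))"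

end

theory Submission
  imports
    "HOL-Algebra.Algebraic_Closure_Type"
    "Berlekamp_Zassenhaus.Finite_Field"
    "HOL-Analysis.Complex_Transcendental"
    "HOL-Analysis.Harmonic_Numbers"
    Defs
begin

text \<open>
Write \<open>E = (\<Sum>a. (-1)\<^sup>a (-1)\<^sup>b)\<close>, where \<open>b\<close> is the inverse of \<open>a\<close>. A Lehmer number contributes \<open>-1\<close>
and every other residue \<open>1\<close>, so \<open>M - (p - 1)/2 = -E/2\<close>. Expand both signs in additive
characters modulo \<open>p\<close> (\<open>parity_inversion\<close>). The Fourier coefficients of \<open>(-1)\<^sup>a\<close> on
\<open>{1..p - 1}\<close> have absolute value \<open>\<bar>tan (\<pi>h/p)\<bar>\<close>, so \<open>E\<close> becomes \<open>p\<^sup>-\<^sup>2\<close> times a sum of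
Kloosterman sums weighted by products of two tangents. Weil's bound \<open>\<bar>K(h,k)\<bar> \<le> 2 \<surd>p\<close> then
gives the first inequality with \<open>\<le>\<close>. It is strict because the sums \<open>K(1,k)\<close> are real and add
up to \<open>1\<close>, which is impossible if all of them are \<open>\<plusminus> 2 \<surd>p\<close>.

Weil's bound has an elementary proof. Let \<open>K\<^sub>q\<close> be the Kloosterman sum
with parameter \<open>a\<close> over the field with \<open>q\<close> elements, a power of \<open>p\<close>. Two facts suffice.

\<^item> \<open>Kl_double\<close>: \<open>K\<^bsub>q\<^sup>2\<^esub> = 2q - K\<^sub>q\<^sup>2\<close>. A monic quadratic over the small field either splits there or
  has a pair of conjugate roots, so the pairs counted by \<open>K\<^sub>q\<^sup>2\<close> and the elements counted by
  \<open>K\<^bsub>q\<^sup>2\<^esub>\<close> together hit each (trace, norm) exactly twice.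
\<^item> \<open>Kl_lower_bound\<close>: \<open>- K\<^sub>q \<le> 3 p \<surd>q + 1\<close> when \<open>q\<close> is an even power of \<open>p\<close>.

Put \<open>r\<^sub>k = - K\<^sub>q / \<surd>q\<close> for \<open>q = p^(2^k)\<close>. The first fact says \<open>r\<^bsub>k+1\<^esub> = r\<^sub>k\<^sup>2 - 2\<close>. If
\<open>\<bar>r\<^sub>0\<bar> > 2\<close>, this recursion tends to infinity, against the second fact.

The second fact is Stepanov's method in the form given to it by Bombieri. It reduces to an upper
bound for the number of points \<open>(x,y)\<close> with \<open>y^p - y = x + a/x\<close> and with \<open>x\<close> and \<open>y\<close> moved by
the \<open>q\<close>-power map in a prescribed way. With \<open>Q = \<surd>q\<close> one looks for a function
\<open>u = \<Sum> d\<^sub>i\<^sub>j w\<^sub>i t\<^sub>j^Q\<close> whose \<open>Q\<close>-th power vanishes at those points. That is a linear system with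
more unknowns than equations over the prime field. The poles of \<open>u\<close> bound its zeros, so the
points number at most about \<open>q\<close> (\<open>card_rational_points_le\<close>). The function is not identically zero
because the terms \<open>w\<^sub>i t\<^sub>j^Q\<close> have distinct orders at a place above \<open>y = \<infinity>\<close>
(\<open>generic_fls\<close>).

For the second inequality, comparison with a telescoping sum of logarithms of cosines gives
\<open>T\<^sub>p \<le> (2/\<pi>)(1 + 0.88/ln p)\<close>, and hence \<open>T\<^sub>p\<^sup>2 < 1/2\<close>, when \<open>ln p \<ge> 8\<close>. For smaller \<open>p\<close> the
trivial bound \<open>(p - 1)/2\<close> is already below \<open>\<surd>p ln\<^sup>2 p / 2\<close>.
\<close>

section \<open>Fields of characteristic p\<close>

lemma degree_monom_minus_X:
  assumes "N > 1"
  shows "degree (monom 1 N - monom 1 1 :: 'a::idom poly) = N"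
proof -
  have "degree (monom 1 N + (- monom 1 1 :: 'a poly)) = degree (monom (1::'a) N)"
    by (rule degree_add_eq_left) (use assms in \<open>simp add: degree_monom_eq\<close>)
  thus ?thesis by (simp add: degree_monom_eq)
qed

text \<open>
The parameter \<open>ty\<close> only fixes the type. All finite fields below are subsets of one field of
characteristic \<open>p\<close>, cut out by equations \<open>x^(p^n) = x\<close>.
\<close>
locale char_p_field =
  fixes ty :: "'a::field itself" and p :: nat
  assumes prime_p: "prime p" and char_p: "CHAR('a) = p"
begin

lemma p_gt_1: "p > 1"
  using prime_gt_1_nat[OF prime_p] .

lemma frob_add: "(x + y :: 'a) ^ (p ^ n) = x ^ (p ^ n) + y ^ (p ^ n)"
  by (rule freshmans_dream') (use prime_p char_p in auto)

lemma frob_diff: "(x - y :: 'a) ^ (p ^ n) = x ^ (p ^ n) - y ^ (p ^ n)"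
  using frob_add[of "x - y" y n] by (simp add: algebra_simps)

lemma frob_sum: "(sum f A :: 'a) ^ (p ^ n) = (\<Sum>i\<in>A. f i ^ (p ^ n))"
  by (rule freshmans_dream_sum') (use prime_p char_p in auto)

definition Fp :: "'a set" where "Fp = {z. z ^ p = z}"

lemma Fp_pow: "z \<in> Fp \<Longrightarrow> z ^ (p ^ n) = z"
  by (induction n) (auto simp: Fp_def power_mult)

lemma Fp_0 [simp]: "0 \<in> Fp" and Fp_1 [simp]: "1 \<in> Fp"
  using p_gt_1 by (auto simp: Fp_def)

lemma Fp_add: "x \<in> Fp \<Longrightarrow> y \<in> Fp \<Longrightarrow> x + y \<in> Fp"
  using frob_add[of x y 1] by (simp add: Fp_def)

lemma Fp_diff: "x \<in> Fp \<Longrightarrow> y \<in> Fp \<Longrightarrow> x - y \<in> Fp"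
  using frob_diff[of x y 1] by (simp add: Fp_def)

lemma Fp_uminus: "x \<in> Fp \<Longrightarrow> - x \<in> Fp"
  using Fp_diff[of 0 x] by simp

lemma Fp_mult: "x \<in> Fp \<Longrightarrow> y \<in> Fp \<Longrightarrow> x * y \<in> Fp"
  by (simp add: Fp_def power_mult_distrib)

lemma Fp_inverse: "x \<in> Fp \<Longrightarrow> inverse x \<in> Fp"
  by (simp add: Fp_def power_inverse)

lemma Fp_sum: "(\<And>i. i \<in> A \<Longrightarrow> f i \<in> Fp) \<Longrightarrow> sum f A \<in> Fp"
  by (induction A rule: infinite_finite_induct) (auto intro: Fp_add)

lemma Fp_of_nat: "of_nat n \<in> Fp"
  by (induction n) (auto intro: Fp_add)

definition artin_schreier :: "'a poly" where "artin_schreier = monom 1 p - monom 1 1"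

lemma poly_artin_schreier [simp]: "poly artin_schreier y = y ^ p - y"
  by (simp add: artin_schreier_def poly_monom)

lemma degree_artin_schreier: "degree artin_schreier = p"
  unfolding artin_schreier_def by (rule degree_monom_minus_X[OF p_gt_1])

lemma artin_schreier_nonzero: "artin_schreier \<noteq> 0"
  using degree_artin_schreier p_gt_1 by auto

lemma Fp_eq_roots: "Fp = {z. poly artin_schreier z = 0}"
  by (auto simp: Fp_def)

lemma finite_Fp: "finite Fp"
  unfolding Fp_eq_roots by (rule poly_roots_finite[OF artin_schreier_nonzero])

text \<open>
The prime field is the set of zeros of \<open>Y^p - Y\<close>; this bounds its size by \<open>p\<close>, and the multiples
of \<open>1\<close> show that the bound is attained.
\<close>
lemma Fp_eq: "Fp = of_nat ` {..<p}" and card_Fp: "card Fp = p"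
proof -
  have inj: "inj_on (of_nat :: nat \<Rightarrow> 'a) {..<p}"
    by (auto simp: inj_on_def of_nat_eq_iff_cong_CHAR char_p cong_def)
  have 1: "card ((of_nat :: nat \<Rightarrow> 'a) ` {..<p}) = p"
    using inj by (simp add: card_image)
  have sub: "(of_nat :: nat \<Rightarrow> 'a) ` {..<p} \<subseteq> Fp"
    by (auto intro: Fp_of_nat)
  have 2: "card Fp \<le> p"
    unfolding Fp_eq_roots using card_poly_roots_bound[OF artin_schreier_nonzero] degree_artin_schreier by simp
  show "Fp = of_nat ` {..<p}"
    using card_seteq[OF finite_Fp sub] 1 2 by simp
  with 1 show "card Fp = p" by simp
qed

definition Fp_coeffs :: "'a poly \<Rightarrow> bool" where "Fp_coeffs f \<longleftrightarrow> (\<forall>i. coeff f i \<in> Fp)"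

lemma Fp_coeffs_0 [simp]: "Fp_coeffs 0"
  by (simp add: Fp_coeffs_def)
lemma Fp_coeffs_add: "Fp_coeffs f \<Longrightarrow> Fp_coeffs g \<Longrightarrow> Fp_coeffs (f + g)"
  by (simp add: Fp_coeffs_def Fp_add)
lemma Fp_coeffs_diff: "Fp_coeffs f \<Longrightarrow> Fp_coeffs g \<Longrightarrow> Fp_coeffs (f - g)"
  by (simp add: Fp_coeffs_def Fp_diff)
lemma Fp_coeffs_mult: "Fp_coeffs f \<Longrightarrow> Fp_coeffs g \<Longrightarrow> Fp_coeffs (f * g)"
  by (simp add: Fp_coeffs_def coeff_mult Fp_sum Fp_mult)
lemma Fp_coeffs_smult: "c \<in> Fp \<Longrightarrow> Fp_coeffs f \<Longrightarrow> Fp_coeffs (smult c f)"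
  by (simp add: Fp_coeffs_def Fp_mult)
lemma Fp_coeffs_sum: "(\<And>i. i \<in> A \<Longrightarrow> Fp_coeffs (f i)) \<Longrightarrow> Fp_coeffs (sum f A)"
  by (induction A rule: infinite_finite_induct) (auto intro: Fp_coeffs_add)
lemma Fp_coeffs_monom: "c \<in> Fp \<Longrightarrow> Fp_coeffs (monom c n)"
  by (simp add: Fp_coeffs_def)
lemma Fp_coeffs_const: "c \<in> Fp \<Longrightarrow> Fp_coeffs [:c:]"
  using Fp_coeffs_monom[of c 0] by (simp add: monom_0)
lemma Fp_coeffs_artin_schreier: "Fp_coeffs artin_schreier"
  unfolding artin_schreier_def by (intro Fp_coeffs_diff Fp_coeffs_monom) auto

definition Fp_polys :: "nat \<Rightarrow> 'a poly set" where "Fp_polys n = {f. Fp_coeffs f \<and> (\<forall>i\<ge>n. coeff f i = 0)}"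

lemma finite_Fp_polys: "finite (Fp_polys n)" and card_Fp_polys_le: "card (Fp_polys n) \<le> p ^ n"
proof -
  let ?\<phi> = "\<lambda>f. restrict (coeff f) {..<n}"
  have inj: "inj_on ?\<phi> (Fp_polys n)"
  proof (rule inj_onI)
    fix f g assume fg: "f \<in> Fp_polys n" "g \<in> Fp_polys n" "?\<phi> f = ?\<phi> g"
    show "f = g"
    proof (rule poly_eqI)
      fix i show "coeff f i = coeff g i"
        using fg(1,2) fun_cong[OF fg(3), of i] unfolding Fp_polys_def
        by (cases "i < n") (simp_all add: restrict_def)
    qed
  qed
  have im: "?\<phi> ` Fp_polys n \<subseteq> {..<n} \<rightarrow>\<^sub>E Fp"
  proof (rule image_subsetI)
    fix f assume "f \<in> Fp_polys n"
    thus "restrict (coeff f) {..<n} \<in> {..<n} \<rightarrow>\<^sub>E Fp"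
      unfolding restrict_PiE_iff by (auto simp: Fp_polys_def Fp_coeffs_def)
  qed
  have fin: "finite ({..<n} \<rightarrow>\<^sub>E Fp)" by (intro finite_PiE) (auto simp: finite_Fp)
  show "finite (Fp_polys n)"
    using inj_on_finite[OF inj im fin] .
  have "card (Fp_polys n) \<le> card ({..<n} \<rightarrow>\<^sub>E Fp)"
    using card_inj_on_le[OF inj im fin] .
  thus "card (Fp_polys n) \<le> p ^ n"
    by (simp add: card_PiE card_Fp)
qed

end

text \<open>
The parameter \<open>a\<close> lies in the prime field, so that the functions below have representations
with coefficients in a field of \<open>p\<close> elements. Their linear dependence can then be found by
counting, and the coefficients are unchanged by Frobenius.
\<close>
locale kloosterman_curve = char_p_field ty p
  for ty :: "'a::field itself" and p +
  fixes a :: 'a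
  assumes a_nonzero: "a \<noteq> 0" and a_in_Fp: "a \<in> Fp"
begin

text \<open>
The Artin--Schreier curve \<open>y^p - y = x + a/x\<close>, multiplied by \<open>x\<close>. In this form it is a double
cover of the \<open>y\<close>-line: the two points above \<open>y\<close> have \<open>x\<close>-coordinates with sum \<open>y^p - y\<close> and product
\<open>a\<close>. This makes norms down to polynomials in \<open>y\<close> explicit.
\<close>
definition curve :: "('a \<times> 'a) set" where
  "curve = {(x, y). x\<^sup>2 - (y ^ p - y) * x + a = 0}"

lemma curve_nonzero: "(x, y) \<in> curve \<Longrightarrow> x \<noteq> 0"
  using a_nonzero by (auto simp: curve_def)

text \<open>
Every function without poles at finite points of the curve has the form \<open>f(y) + g(y) x\<close>. Both
places above \<open>y = \<infinity>\<close> are poles of \<open>y\<close> of order \<open>1\<close> and \<open>x\<close> has a pole of order at most \<open>p\<close>, so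
the two degree conditions bound both pole orders by \<open>s\<close>. Where \<open>s + 1 \<le> p\<close>, the truncated
difference \<open>s + 1 - p\<close> is \<open>0\<close>, which forces \<open>g = 0\<close>, as intended.
\<close>
definition represents :: "nat \<Rightarrow> ('a \<Rightarrow> 'a \<Rightarrow> 'a) \<Rightarrow> 'a poly \<Rightarrow> 'a poly \<Rightarrow> bool" where
  "represents s H f g \<longleftrightarrow> f \<in> Fp_polys (s + 1) \<and> g \<in> Fp_polys (s + 1 - p)
     \<and> (\<forall>(x, y)\<in>curve. H x y = poly f y + poly g y * x)"

definition regular :: "nat \<Rightarrow> ('a \<Rightarrow> 'a \<Rightarrow> 'a) \<Rightarrow> bool" where
  "regular s H \<longleftrightarrow> (\<exists>f g. represents s H f g)"

lemma Fp_polys_iff: "f \<in> Fp_polys n \<longleftrightarrow> Fp_coeffs f \<and> (f = 0 \<or> degree f < n)"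
proof
  assume "f \<in> Fp_polys n"
  thus "Fp_coeffs f \<and> (f = 0 \<or> degree f < n)"
    using leading_coeff_0_iff[of f] by (auto simp: Fp_polys_def not_less)
next
  assume *: "Fp_coeffs f \<and> (f = 0 \<or> degree f < n)"
  have "coeff f i = 0" if "i \<ge> n" for i
    using * that by (elim conjE disjE) (auto intro: coeff_eq_0)
  thus "f \<in> Fp_polys n" using * by (simp add: Fp_polys_def)
qed

lemma regular_mono: "regular s H \<Longrightarrow> s \<le> t \<Longrightarrow> regular t H"
proof -
  assume H: "regular s H" and st: "s \<le> t"
  have sub: "Fp_polys m \<subseteq> Fp_polys n" if "m \<le> n" for m n
    using that by (auto simp: Fp_polys_def)
  have "Fp_polys (s + 1) \<subseteq> Fp_polys (t + 1)" "Fp_polys (s + 1 - p) \<subseteq> Fp_polys (t + 1 - p)"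
    by (rule sub, use st in simp)+
  thus ?thesis using H unfolding regular_def represents_def by blast
qed

lemma regular_const: "c \<in> Fp \<Longrightarrow> regular 0 (\<lambda>x y. c)"
  unfolding regular_def represents_def
  by (intro exI[of _ "[:c:]"] exI[of _ 0]) (auto simp: Fp_polys_iff Fp_coeffs_const)

lemma regular_y: "c \<in> Fp \<Longrightarrow> regular 1 (\<lambda>x y. y + c)"
proof -
  assume c: "c \<in> Fp"
  have "degree (monom 1 1 + [:c:]) \<le> 1"
    by (intro degree_add_le degree_monom_le) simp
  hence "monom 1 1 + [:c:] \<in> Fp_polys (1 + 1)"
    using c by (simp add: Fp_polys_iff Fp_coeffs_const Fp_coeffs_add Fp_coeffs_monom)
  moreover have "0 \<in> Fp_polys (1 + 1 - p)" by (simp add: Fp_polys_iff)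
  ultimately show ?thesis
    unfolding regular_def represents_def
    by (intro exI[of _ "monom 1 1 + [:c:]"] exI[of _ 0]) (simp add: poly_monom)
qed

lemma regular_x: "regular p (\<lambda>x y. x)"
  unfolding regular_def represents_def
  by (intro exI[of _ 0] exI[of _ 1]) (auto simp: Fp_polys_iff Fp_coeffs_def coeff_1)

text \<open>
The conjugate of \<open>x\<close> over the \<open>y\<close>-line is \<open>a/x = y^p - y - x\<close>, so the inverse of \<open>x\<close> is again
polynomial.
\<close>
lemma regular_inv_x: "regular p (\<lambda>x y. inverse x)"
proof -
  have "inverse x = poly (smult (inverse a) artin_schreier) y + poly [:- inverse a:] y * x" if "(x, y) \<in> curve" for x y
  proof -
    have nz: "x \<noteq> 0" by (rule curve_nonzero[OF that])
    have "x * (y ^ p - y - x) = a"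
      using that by (simp add: curve_def algebra_simps power2_eq_square eq_neg_iff_add_eq_0)
    hence "inverse x = inverse a * (y ^ p - y - x)" 
      using nz a_nonzero by (simp add: field_simps)
    thus ?thesis by (simp add: algebra_simps)
  qed
  moreover have "smult (inverse a) artin_schreier \<in> Fp_polys (p + 1)" 
    using a_in_Fp by (auto simp: Fp_polys_iff Fp_coeffs_smult Fp_coeffs_artin_schreier Fp_inverse degree_artin_schreier)
  moreover have "[:- inverse a:] \<in> Fp_polys (p + 1 - p)"
    using a_in_Fp by (auto simp: Fp_polys_iff Fp_uminus Fp_inverse Fp_coeffs_const)
  ultimately show ?thesis
    unfolding regular_def represents_def by blast
qed

lemma regular_add:
  assumes "regular s H" "regular s K"
  shows "regular s (\<lambda>x y. H x y + K x y)"
proof -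
  from assms obtain f g f' g' where 1: "represents s H f g" and 2: "represents s K f' g'" by (auto simp: regular_def)
  have "f + f' \<in> Fp_polys (s + 1)" "g + g' \<in> Fp_polys (s + 1 - p)"
    using 1 2 by (auto simp: represents_def Fp_polys_def Fp_coeffs_add)
  moreover have "H x y + K x y = poly (f + f') y + poly (g + g') y * x" if "(x, y) \<in> curve" for x y
  proof -
    have "H x y = poly f y + poly g y * x" "K x y = poly f' y + poly g' y * x"
      using 1 2 that by (auto simp: represents_def)
    thus ?thesis by (simp add: algebra_simps)
  qed
  ultimately show ?thesis unfolding regular_def represents_def by blast
qed

text \<open>
Reduce \<open>x\<^sup>2\<close> by the equation \<open>x\<^sup>2 = (y^p - y) x - a\<close>; the degree \<open>p\<close> of \<open>y^p - y\<close> is exactly what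
the weight \<open>p\<close> of \<open>x\<close> pays for.
\<close>
lemma regular_mult:
  assumes "regular s H" "regular t K"
  shows "regular (s + t) (\<lambda>x y. H x y * K x y)"
proof -
  from assms obtain f g f' g' where 1: "represents s H f g" and 2: "represents t K f' g'"
    by (auto simp: regular_def)
  let ?F = "f * f' - smult a (g * g')" and ?G = "f * g' + g * f' + g * g' * artin_schreier"
  have z: "coeff f i = 0" if "i > s" for i using that 1 by (auto simp: represents_def Fp_polys_def)
  have z': "coeff f' i = 0" if "i > t" for i using that 2 by (auto simp: represents_def Fp_polys_def)
  have df: "degree f \<le> s" using z by (intro degree_le) auto
  have df': "degree f' \<le> t" using z' by (intro degree_le) auto
  have dg: "g = 0 \<or> degree g + p \<le> s" using 1 by (auto simp: represents_def Fp_polys_iff)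
  have dg': "g' = 0 \<or> degree g' + p \<le> t" using 2 by (auto simp: represents_def Fp_polys_iff)
  have c: "Fp_coeffs f" "Fp_coeffs g" "Fp_coeffs f'" "Fp_coeffs g'"
    using 1 2 by (auto simp: represents_def Fp_polys_iff)
  have "degree (f * f') \<le> s + t"
    using df df' degree_mult_le[of f f'] by linarith
  moreover have "degree (smult a (g * g')) \<le> s + t"
    using dg dg' degree_mult_le[of g g'] a_nonzero by auto
  ultimately have "degree ?F \<le> s + t" by (rule degree_diff_le)
  hence F: "?F \<in> Fp_polys (s + t + 1)"
    using c a_in_Fp by (auto simp: Fp_polys_iff intro!: Fp_coeffs_diff Fp_coeffs_mult Fp_coeffs_smult)
  have q1: "coeff (f * g') i = 0" if "i \<ge> s + t + 1 - p" for i
    using that dg' df degree_mult_le[of f g'] by (cases "g' = 0") (auto intro!: coeff_eq_0)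
  have q2: "coeff (g * f') i = 0" if "i \<ge> s + t + 1 - p" for i
    using that dg df' degree_mult_le[of g f'] by (cases "g = 0") (auto intro!: coeff_eq_0)
  have q3: "coeff (g * g' * artin_schreier) i = 0" if "i \<ge> s + t + 1 - p" for i
  proof (cases "g = 0 \<or> g' = 0")
    case False
    thus ?thesis
      using that dg dg' degree_mult_le[of g g'] degree_mult_le[of "g * g'" artin_schreier] degree_artin_schreier
      by (intro coeff_eq_0) linarith
  qed auto
  have G: "?G \<in> Fp_polys (s + t + 1 - p)"
    using c q1 q2 q3 unfolding Fp_polys_def by (auto intro!: Fp_coeffs_add Fp_coeffs_mult Fp_coeffs_artin_schreier)
  have "H x y * K x y = poly ?F y + poly ?G y * x" if "(x, y) \<in> curve" for x y
  proof -
    have *: "x\<^sup>2 = (y ^ p - y) * x - a" using that by (auto simp: curve_def algebra_simps)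
    have "H x y = poly f y + poly g y * x" "K x y = poly f' y + poly g' y * x"
      using 1 2 that by (auto simp: represents_def)
    hence "H x y * K x y = poly f y * poly f' y + (poly f y * poly g' y + poly g y * poly f' y) * x
        + poly g y * poly g' y * x\<^sup>2"
      by (simp add: algebra_simps power2_eq_square)
    thus ?thesis unfolding * by (simp add: algebra_simps)
  qed
  with F G show ?thesis
    unfolding regular_def represents_def by blast
qed

lemma regular_power: "regular s H \<Longrightarrow> regular (n * s) (\<lambda>x y. H x y ^ n)"
proof (induction n)
  case (Suc n)
  from regular_mult[OF Suc.prems Suc.IH[OF Suc.prems]] show ?case by simp
qed (use regular_const[of 1] in simp)

lemma regular_power_int_x: "regular (nat \<bar>n\<bar> * p) (\<lambda>x y. x powi n)"
proof (cases "n \<ge> 0")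
  case True
  thus ?thesis using regular_power[OF regular_x, of "nat n"] by (simp add: power_int_def)
next
  case False
  thus ?thesis using regular_power[OF regular_inv_x, of "nat (-n)"] by (simp add: power_int_def)
qed

text \<open>
The monomials \<open>x^i y^j\<close> with \<open>i\<close> an integer and \<open>0 \<le> j < p\<close>, numbered by \<open>n = p i + j\<close>. This number
is the pole order at the place where \<open>x = \<infinity>\<close>, so different monomials have different
orders there.
\<close>
definition xy_monomial :: "int \<Rightarrow> 'a \<Rightarrow> 'a \<Rightarrow> 'a" where
  "xy_monomial n x y = x powi (n div int p) * y ^ nat (n mod int p)"

text \<open>
The numbers \<open>n = p i + j\<close> of the monomials with \<open>\<bar>i\<bar> \<le> l\<close>. Symmetry in \<open>i\<close> balances the poles at the
two places at infinity. A window contains as many numbers as the total pole order it allows, up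
to a bounded error, and this keeps the leading term of the final bound at \<open>q\<close>.
\<close>
definition window :: "nat \<Rightarrow> int set" where
  "window l = {- int (p * l) .. int (p * l) + int p - 1}"

lemma card_window: "card (window l) = p * (2 * l + 1)"
  by (simp add: window_def nat_eq_iff algebra_simps)

lemma finite_window [simp]: "finite (window l)"
  by (simp add: window_def)

lemma window_div: "n \<in> window l \<Longrightarrow> \<bar>n div int p\<bar> \<le> int l"
proof -
  assume n: "n \<in> window l"
  have pp: "int p > 0" using p_gt_1 by simp
  have "n div int p \<le> (int p * int l + (int p - 1)) div int p"
    by (rule zdiv_mono1) (use n pp in \<open>auto simp: window_def\<close>)
  also have "\<dots> = int l" using pp by (simp add: div_mult_self2 add.commute)
  finally have 1: "n div int p \<le> int l" .
  have "(- int (p * l)) div int p \<le> n div int p"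
    by (rule zdiv_mono1) (use n pp in \<open>auto simp: window_def\<close>)
  moreover have "(- int (p * l)) div int p = - int l"
    using pp by (simp flip: mult_minus_right)
  ultimately show ?thesis using 1 by linarith
qed

lemma regular_monomial: 
  assumes "n \<in> window l" "c \<in> Fp"
  shows "regular (p * l + p - 1) (\<lambda>x y. xy_monomial n x (y + c))"
proof -
  have m: "0 \<le> n mod int p" "n mod int p < int p" using p_gt_1 by auto
  have "regular (nat \<bar>n div int p\<bar> * p + nat (n mod int p) * 1)
      (\<lambda>x y. x powi (n div int p) * (y + c) ^ nat (n mod int p))"
    by (intro regular_mult regular_power_int_x regular_power regular_y assms)
  moreover have "nat \<bar>n div int p\<bar> * p \<le> p * l"
    using window_div[OF assms(1)] by (subst mult.commute, intro mult_le_mono2) linarith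
  moreover have "nat (n mod int p) \<le> p - 1" using m p_gt_1 by linarith
  ultimately show ?thesis
    unfolding xy_monomial_def using p_gt_1 by (elim regular_mono) linarith
qed

text \<open>
Siegel's argument by pigeonhole: the functions regular of size \<open>s\<close> are described by
\<open>(s + 1) + (s + 1 - p)\<close> coefficients from the prime field, so among more functions than
that, two different combinations agree.
\<close>
lemma linear_relation:
  assumes fin: "finite I" and card: "card I > 2 * s + 2 - p" and ps: "p \<le> s + 1"
    and U: "\<And>i. i \<in> I \<Longrightarrow> regular s (U i)"
  shows "\<exists>d. (\<forall>i\<in>I. d i \<in> Fp) \<and> (\<exists>i\<in>I. d i \<noteq> 0)
    \<and> (\<forall>x y. (x, y) \<in> curve \<longrightarrow> (\<Sum>i\<in>I. d i * U i x y) = 0)"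
proof -
  have "\<forall>i\<in>I. \<exists>f g. represents s (U i) f g" using U unfolding regular_def by blast
  then obtain f where "\<forall>i\<in>I. \<exists>g. represents s (U i) (f i) g" by (rule bchoice[THEN exE])
  then obtain g where "\<forall>i\<in>I. represents s (U i) (f i) (g i)" by (rule bchoice[THEN exE])
  hence rep: "represents s (U i) (f i) (g i)" if "i \<in> I" for i using that by blast
  define \<Phi> where "\<Phi> = (\<lambda>d. (\<Sum>i\<in>I. smult (d i) (f i), \<Sum>i\<in>I. smult (d i) (g i)))"
  have lincomb: "(\<Sum>i\<in>I. smult (d i) (h i)) \<in> Fp_polys n" 
    if "d \<in> I \<rightarrow>\<^sub>E Fp" "\<And>i. i \<in> I \<Longrightarrow> h i \<in> Fp_polys n" for d h n
    using that unfolding Fp_polys_def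
    by (auto intro!: Fp_coeffs_sum Fp_coeffs_smult simp: coeff_sum)
  have im: "\<Phi> ` (I \<rightarrow>\<^sub>E Fp) \<subseteq> Fp_polys (s + 1) \<times> Fp_polys (s + 1 - p)"
    using rep unfolding \<Phi>_def by (auto intro!: lincomb simp: represents_def)
  have "card (\<Phi> ` (I \<rightarrow>\<^sub>E Fp)) \<le> card (Fp_polys (s + 1) \<times> Fp_polys (s + 1 - p))"
    by (rule card_mono[OF _ im]) (simp add: finite_Fp_polys)
  also have "\<dots> \<le> p ^ (s + 1) * p ^ (s + 1 - p)"
    unfolding card_cartesian_product by (intro mult_mono card_Fp_polys_le) auto
  also have "\<dots> = p ^ (2 * s + 2 - p)"
  proof -
    have "2 * s + 2 - p = (s + 1) + (s + 1 - p)" using ps by linarith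
    thus ?thesis by (simp only: power_add)
  qed
  also have "\<dots> < p ^ card I"
    using card p_gt_1 by (intro power_strict_increasing) auto
  also have "\<dots> = card (I \<rightarrow>\<^sub>E Fp)"
    using fin by (simp add: card_PiE card_Fp)
  finally have "\<not> inj_on \<Phi> (I \<rightarrow>\<^sub>E Fp)"
    using pigeonhole by blast
  then obtain d1 d2 where d: "d1 \<in> I \<rightarrow>\<^sub>E Fp" "d2 \<in> I \<rightarrow>\<^sub>E Fp" "d1 \<noteq> d2" "\<Phi> d1 = \<Phi> d2"
    by (auto simp: inj_on_def)
  have "\<exists>i\<in>I. d1 i \<noteq> d2 i" using d PiE_ext by metis
  moreover have "(\<Sum>i\<in>I. (d1 i - d2 i) * U i x y) = 0" if xy: "(x, y) \<in> curve" for x y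
  proof -
    have v: "(\<Sum>i\<in>I. d i * U i x y) = poly (fst (\<Phi> d)) y + poly (snd (\<Phi> d)) y * x" for d
    proof -
      have "(\<Sum>i\<in>I. d i * U i x y) = (\<Sum>i\<in>I. d i * (poly (f i) y + poly (g i) y * x))"
        using rep xy by (intro sum.cong) (auto simp: represents_def)
      thus ?thesis
        by (simp add: \<Phi>_def poly_sum algebra_simps sum.distrib sum_distrib_left)
    qed
    have "(\<Sum>i\<in>I. (d1 i - d2 i) * U i x y) = (\<Sum>i\<in>I. d1 i * U i x y) - (\<Sum>i\<in>I. d2 i * U i x y)"
      by (simp add: left_diff_distrib sum_subtractf)
    thus ?thesis unfolding v d(4) by simp
  qed
  ultimately show ?thesis
    using d by (intro exI[of _ "\<lambda>i. d1 i - d2 i"]) (auto intro!: Fp_diff)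
qed

text \<open>
For \<open>H = f(y) + g(y) x\<close> the norm \<open>N = f\<^sup>2 + f g (y^p - y) + a g\<^sup>2\<close> is a polynomial in \<open>y\<close> of degree at
most \<open>2 s\<close>. A zero of \<open>H\<close> lies above a zero of \<open>N\<close>, and if both points above \<open>y\<close> are zeros, then
\<open>f\<close> and \<open>g\<close> vanish at \<open>y\<close> and \<open>N\<close> vanishes doubly. The points \<open>(x1, y1)\<close> and \<open>(x2, y1)\<close> are
conjugate to each other, so \<open>N\<close> takes at \<open>y1\<close> the product of the two values of \<open>H\<close> there; hence
\<open>N \<noteq> 0\<close>.
\<close>
lemma card_zeros_le:
  assumes "regular s H" and Z: "Z \<subseteq> curve" "\<And>x y. (x, y) \<in> Z \<Longrightarrow> H x y = 0"
    and g: "(x1, y1) \<in> curve" "(x2, y1) \<in> curve" "x1 * x2 = a" "H x1 y1 \<noteq> 0" "H x2 y1 \<noteq> 0"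
  shows "finite Z \<and> card Z \<le> 2 * s"
proof -
  from assms obtain f g where rep: "represents s H f g" by (auto simp: regular_def)
  have H: "H x y = poly f y + poly g y * x" if "(x, y) \<in> curve" for x y
    using rep that by (auto simp: represents_def)
  have df: "degree f \<le> s" using rep by (auto simp: represents_def Fp_polys_iff)
  have dg: "g = 0 \<or> degree g + p \<le> s" using rep by (auto simp: represents_def Fp_polys_iff)
  define N where "N = f * f + f * g * artin_schreier + smult a (g * g)"
  have N: "poly N y = (poly f y + poly g y * x) * (poly f y + poly g y * (y ^ p - y - x))"
    if "(x, y) \<in> curve" for x y
  proof -
    have a: "a = (y ^ p - y) * x - x * x" 
      using that by (auto simp: curve_def algebra_simps power2_eq_square eq_neg_iff_add_eq_0)
    show ?thesis by (simp add: N_def algebra_simps) (simp add: a algebra_simps)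
  qed
  have x2: "x2 = y1 ^ p - y1 - x1"
  proof -
    have "x1 * (y1 ^ p - y1 - x1) = x1 * x2"
      using g(1,3) by (auto simp: curve_def algebra_simps power2_eq_square)
    thus ?thesis using curve_nonzero[OF g(1)] by simp
  qed
  have "poly N y1 = H x1 y1 * H x2 y1"
    using N[OF g(1)] g(1,2) by (simp add: H flip: x2)
  with g have N0: "N \<noteq> 0" by auto
  have degN: "degree N \<le> 2 * s"
  proof -
    have 1: "degree (f * f) \<le> 2 * s" using df degree_mult_le[of f f] by linarith
    have 2: "degree (f * g * artin_schreier) \<le> 2 * s"
      using df dg degree_mult_le[of f g] degree_mult_le[of "f * g" artin_schreier] degree_artin_schreier by (cases "g = 0") auto
    have 3: "degree (smult a (g * g)) \<le> 2 * s"
      using dg degree_mult_le[of g g] degree_smult_le[of a "g * g"] by (cases "g = 0") auto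
    show ?thesis unfolding N_def by (intro degree_add_le 1 2 3)
  qed
  \<comment> \<open>The zeros above \<open>y\<close> number at most the multiplicity of \<open>y\<close> as a root of \<open>N\<close>.\<close>
  define R where "R = {y. poly N y = 0}"
  have finR: "finite R" unfolding R_def by (rule poly_roots_finite[OF N0])
  define F where "F = (\<lambda>y. {x. (x, y) \<in> Z})"
  have fib: "F y \<subseteq> {x, y ^ p - y - x}" if "x \<in> F y" for x y
  proof
    fix x' assume "x' \<in> F y"
    hence "(x', y) \<in> curve" "(x, y) \<in> curve" using that Z by (auto simp: F_def)
    hence "x'\<^sup>2 - (y ^ p - y) * x' + a - (x\<^sup>2 - (y ^ p - y) * x + a) = 0"
      by (simp add: curve_def)
    hence "(x' - x) * (x' - (y ^ p - y - x)) = 0"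
      by (simp add: algebra_simps power2_eq_square)
    thus "x' \<in> {x, y ^ p - y - x}" by auto
  qed
  have finF: "finite (F y)" for y
  proof (cases "F y = {}")
    case False
    then obtain x where "x \<in> F y" by blast
    from finite_subset[OF fib[OF this]] show ?thesis by simp
  qed simp
  have ord: "card (F y) \<le> Polynomial.order y N" for y
  proof (cases "F y = {}")
    case False
    then obtain x where x: "x \<in> F y" by auto
    hence xc: "(x, y) \<in> curve" "H x y = 0" using Z by (auto simp: F_def)
    have fgx: "poly f y + poly g y * x = 0" using H[OF xc(1)] xc(2) by (rule trans[OF sym])
    have r: "poly N y = 0" unfolding N[OF xc(1)] fgx by (rule mult_zero_left)
    show ?thesis
    proof (cases "F y = {x}")
      case True
      thus ?thesis using r order_root[of N y] N0 by simp
    next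
      case False
      define x' where "x' = y ^ p - y - x"
      have "F y \<subseteq> {x, x'}" using fib[OF x] x'_def by simp
      hence x': "x' \<in> F y" "x \<noteq> x'" "card (F y) \<le> 2"
        using False x by (auto dest: card_mono[rotated] simp: card_insert_if split: if_splits)
      have xc': "(x', y) \<in> curve" "H x' y = 0" using x' Z by (auto simp: F_def)
      have e: "poly f y + poly g y * x = 0" "poly f y + poly g y * x' = 0"
        using H[OF xc(1)] H[OF xc'(1)] xc(2) xc'(2) by simp_all
      have "poly g y * (x - x') = (poly f y + poly g y * x) - (poly f y + poly g y * x')"
        by (simp add: algebra_simps)
      also have "\<dots> = 0" unfolding e by simp
      finally have g0: "poly g y = 0" using x' by simp
      hence f0: "poly f y = 0" using e by simp
      have fd: "[:-y, 1:] dvd f" and gd: "[:-y, 1:] dvd g" 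
        using f0 g0 by (simp_all add: poly_eq_0_iff_dvd)
      have "[:-y, 1:] ^ 2 dvd N"
        unfolding N_def power2_eq_square
        by (intro dvd_add dvd_smult mult_dvd_mono fd gd dvd_mult2)
      hence "2 \<le> Polynomial.order y N" using N0 order_max by blast
      thus ?thesis using x' by linarith
    qed
  qed auto
  have inR: "y \<in> R" if "(x, y) \<in> Z" for x y
  proof -
    have "(x, y) \<in> curve" "H x y = 0" using Z that by auto
    thus ?thesis using N[of x y] H[of x y] by (simp add: R_def)
  qed
  have Zeq: "Z = (\<lambda>(y, x). (x, y)) ` (SIGMA y:R. F y)"
    using inR by (force simp: F_def)
  have finS: "finite (SIGMA y:R. F y)" using finR finF by auto
  have "card Z \<le> card (SIGMA y:R. F y)"
    unfolding Zeq by (rule card_image_le[OF finS])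
  also have "\<dots> = (\<Sum>y\<in>R. card (F y))"
    using finR finF by simp
  also have "\<dots> \<le> (\<Sum>y\<in>R. Polynomial.order y N)"
    by (intro sum_mono ord)
  also have "\<dots> \<le> degree N"
    unfolding R_def by (rule sum_order_le_degree[OF N0])
  finally show ?thesis using degN finS Zeq by auto
qed

text \<open>
For \<open>x\<close> in the field with \<open>q\<close> elements and \<open>y^q = y + c\<close>, the \<open>q\<close>-power map acts on monomials as
the translation \<open>y \<mapsto> y + c\<close>. Allowing a shift \<open>c\<close> treats all fibres of the trace at once.
\<close>
lemma monomial_frob:
  assumes "x ^ q = x" "y ^ q = y + c"
  shows "xy_monomial n x y ^ q = xy_monomial n x (y + c)"
proof -
  have pw: "(x ^ k) ^ q = x ^ k" for k
  proof -
    have "(x ^ k) ^ q = (x ^ q) ^ k" by (simp only: power_mult [symmetric] mult.commute)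
    thus ?thesis using assms(1) by simp
  qed
  have "(x powi k) ^ q = x powi k" for k
    unfolding power_int_def by (simp add: pw power_inverse)
  moreover have "(y ^ j) ^ q = (y + c) ^ j" for j
  proof -
    have "(y ^ j) ^ q = (y ^ q) ^ j" by (simp only: power_mult [symmetric] mult.commute)
    thus ?thesis using assms(2) by simp
  qed
  ultimately show ?thesis by (simp add: xy_monomial_def power_mult_distrib)
qed

text \<open>
A point is generic for the construction if no nontrivial combination
\<open>\<Sum> d\<^sub>i\<^sub>j w\<^sub>i t\<^sub>j^Q\<close> with coefficients in the prime field vanishes there.
\<close>
definition generic :: "nat \<Rightarrow> nat \<Rightarrow> nat \<Rightarrow> 'a \<Rightarrow> 'a \<Rightarrow> bool" where
  "generic Q l m x y \<longleftrightarrow> (\<forall>d. (\<forall>i\<in>window l \<times> window m. d i \<in> Fp) \<longrightarrow> (\<exists>i\<in>window l \<times> window m. d i \<noteq> 0) \<longrightarrow>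
     (\<Sum>i\<in>window l \<times> window m. d i * (xy_monomial (fst i) x y * xy_monomial (snd i) x y ^ Q)) \<noteq> 0)"

text \<open>
The auxiliary function is \<open>H = \<Sum> d\<^sub>i\<^sub>j w\<^sub>i t\<^sub>j^Q\<close> with \<open>w\<^sub>i\<close> from the window \<open>l\<close> and \<open>t\<^sub>j\<close> from the window
\<open>l + 1\<close>. At a point of \<open>Z\<close> its \<open>Q\<close>-th power is \<open>\<Sum> d\<^sub>i\<^sub>j w\<^sub>i^Q t\<^sub>j(x, y + c)\<close>, because the \<open>q\<close>-th power
of \<open>t\<^sub>j\<close> is its translate and the coefficients are unchanged by Frobenius. There are \<open>Q (Q + 2p)\<close>
coefficients, more than the dimension of the space containing the functions \<open>w\<^sub>i^Q t\<^sub>j(x, y + c)\<close>, so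
they can be chosen to make that sum vanish on the whole curve. Then \<open>H\<close> vanishes on \<open>Z\<close>, and its total
pole order, which is \<open>Q\<^sup>2\<close> up to a multiple of \<open>p Q\<close>, bounds the size of \<open>Z\<close>.
\<close>
lemma card_rational_points_le:
  assumes Q: "Q = p ^ \<mu>" and l: "p * (2 * l + 1) = Q" 
    and g: "(x1, y1) \<in> curve" "(x2, y1) \<in> curve" "x1 * x2 = a"
      "generic Q l (l + 1) x1 y1" "generic Q l (l + 1) x2 y1"
    and c: "c \<in> Fp"
    and Z: "Z \<subseteq> curve" "\<And>x y. (x, y) \<in> Z \<Longrightarrow> x ^ Q\<^sup>2 = x \<and> y ^ Q\<^sup>2 = y + c"
  shows "finite Z \<and> card Z \<le> Q\<^sup>2 + 3 * p * Q"
proof -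
  define I where "I = window l \<times> window (l + 1)"
  define s where "s = Q * (p * l + p - 1) + (p * (l + 1) + p - 1)"
  define U where "U = (\<lambda>i x y. xy_monomial (fst i) x (y + 0) ^ Q * xy_monomial (snd i) x (y + c))"
  have finI: "finite I" by (simp add: I_def)
  have cardI: "card I = Q * (Q + 2 * p)"
    using l by (simp add: I_def card_cartesian_product card_window algebra_simps)
  have regU: "regular s (U i)" if "i \<in> I" for i
    unfolding U_def s_def using that c by (intro regular_mult regular_power regular_monomial) (auto simp: I_def)
  \<comment> \<open>The pole orders that the two windows allow at each of the two places.\<close>
  define A where "A = p * l + p - 1"
  define B where "B = p * (l + 1) + p - 1"
  have Ql: "2 * (p * l) + p = Q" using l by (simp add: algebra_simps)
  have A2: "2 * A + 2 = Q + p" and B2: "2 * B + 2 = Q + 3 * p"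
    using Ql p_gt_1 unfolding A_def B_def by simp_all
  have Q2: "Q \<ge> 2" "Q \<ge> p" using Ql p_gt_1 by linarith+
  have c1: "2 * s + 2 - p < card I"
  proof -
    have "2 * s + 2 + 2 * Q = Q * (2 * A + 2) + (2 * B + 2)"
      unfolding s_def A_def [symmetric] B_def [symmetric] by (simp only: algebra_simps)
    hence "2 * s + 2 + 2 * Q = Q * (Q + p) + (Q + 3 * p)" unfolding A2 B2 .
    moreover have "Q * (Q + 2 * p) = Q * (Q + p) + Q * p" by (simp only: algebra_simps)
    moreover have "2 * p \<le> Q * p" using Q2 by simp
    ultimately show ?thesis unfolding cardI using Q2 p_gt_1 by linarith
  qed
  have c2: "p \<le> s + 1" 
  proof -
    have "p \<le> B + 1" using p_gt_1 by (simp add: B_def)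
    also have "B \<le> s" unfolding s_def B_def by simp
    finally show ?thesis by simp
  qed
  obtain d where "(\<forall>i\<in>I. d i \<in> Fp) \<and> (\<exists>i\<in>I. d i \<noteq> 0)
      \<and> (\<forall>x y. (x, y) \<in> curve \<longrightarrow> (\<Sum>i\<in>I. d i * U i x y) = 0)"
    using linear_relation[OF finI c1 c2 regU] by (rule exE)
  hence d: "\<And>i. i \<in> I \<Longrightarrow> d i \<in> Fp" "\<exists>i\<in>I. d i \<noteq> 0"
    "\<And>x y. (x, y) \<in> curve \<Longrightarrow> (\<Sum>i\<in>I. d i * U i x y) = 0"
    by blast+
  define t where "t = (p * l + p - 1) + Q * (p * (l + 1) + p - 1)"
  define H where "H = (\<lambda>x y. \<Sum>i\<in>I. d i * (xy_monomial (fst i) x y * xy_monomial (snd i) x y ^ Q))"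
  have regular_term: "regular t (\<lambda>x y. d i * (xy_monomial (fst i) x (y + 0) * xy_monomial (snd i) x (y + 0) ^ Q))" if "i \<in> I" for i
  proof -
    have "regular (0 + ((p * l + p - 1) + Q * (p * (l + 1) + p - 1))) 
        (\<lambda>x y. d i * (xy_monomial (fst i) x (y + 0) * xy_monomial (snd i) x (y + 0) ^ Q))"
    proof (rule regular_mult[OF regular_const regular_mult[OF regular_monomial regular_power[OF regular_monomial]]])
      show "d i \<in> Fp" by (rule d(1)[OF that])
      show "fst i \<in> window l" "snd i \<in> window (l + 1)" using that unfolding I_def by auto
    qed simp_all
    thus ?thesis by (simp only: t_def add_0)
  qed
  have regH: "regular t H"
  proof -
    have "regular t (\<lambda>x y. \<Sum>i\<in>J. d i * (xy_monomial (fst i) x y * xy_monomial (snd i) x y ^ Q))" if "J \<subseteq> I" for J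
    proof -
      have "finite J" using that finI finite_subset by blast
      thus ?thesis using that
      proof (induction J)
        case empty
        show ?case using regular_mono[OF regular_const[OF Fp_0], of t] by simp
      next
        case (insert i J)
        have "regular t (\<lambda>x y. d i * (xy_monomial (fst i) x y * xy_monomial (snd i) x y ^ Q))"
          using regular_term[of i] insert.prems by simp
        hence "regular t (\<lambda>x y. d i * (xy_monomial (fst i) x y * xy_monomial (snd i) x y ^ Q) +
            (\<Sum>i\<in>J. d i * (xy_monomial (fst i) x y * xy_monomial (snd i) x y ^ Q)))"
          using insert.IH insert.prems by (intro regular_add) simp_all
        thus ?case using insert.hyps by simp
      qed
    qed
    thus ?thesis unfolding H_def by simp
  qed
  have H0: "H x y = 0" if "(x, y) \<in> Z" for x y
  proof -
    have q: "x ^ Q\<^sup>2 = x" "y ^ Q\<^sup>2 = y + c" and xy: "(x, y) \<in> curve" using Z that by auto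
    have "H x y ^ Q = (\<Sum>i\<in>I. (d i * (xy_monomial (fst i) x y * xy_monomial (snd i) x y ^ Q)) ^ Q)"
      unfolding H_def Q by (rule frob_sum)
    also have "\<dots> = (\<Sum>i\<in>I. d i * U i x y)"
    proof (rule sum.cong)
      fix i assume i: "i \<in> I"
      have "(xy_monomial (snd i) x y ^ Q) ^ Q = xy_monomial (snd i) x (y + c)"
        using monomial_frob[OF q, of "snd i"] by (simp add: power2_eq_square flip: power_mult)
      moreover have "d i ^ Q = d i" unfolding Q by (rule Fp_pow[OF d(1)[OF i]])
      ultimately show "(d i * (xy_monomial (fst i) x y * xy_monomial (snd i) x y ^ Q)) ^ Q = d i * U i x y"
        by (simp add: U_def power_mult_distrib)
    qed simp
    also have "\<dots> = 0" by (rule d(3)[OF xy])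
    finally show ?thesis by simp
  qed
  \<comment> \<open>So far \<open>H\<close> could be identically zero; the generic points exclude that.\<close>
  have "H x1 y1 \<noteq> 0" "H x2 y1 \<noteq> 0"
    using g(4,5)[unfolded generic_def, rule_format, of d] d(1,2) unfolding H_def I_def by auto
  from card_zeros_le[OF regH Z(1) H0 g(1-3) this]
  have "finite Z" "card Z \<le> 2 * t" by auto
  moreover have "2 * t \<le> Q\<^sup>2 + 3 * p * Q"
  proof -
    have "2 * t + 2 + 2 * Q = (2 * A + 2) + Q * (2 * B + 2)"
      unfolding t_def A_def [symmetric] B_def [symmetric] by (simp only: algebra_simps)
    hence "2 * t + 2 + 2 * Q = (Q + p) + Q * (Q + 3 * p)" unfolding A2 B2 .
    moreover have "Q * (Q + 3 * p) = Q\<^sup>2 + 3 * p * Q" by (simp only: algebra_simps power2_eq_square)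
    ultimately show ?thesis using Q2 by linarith
  qed
  ultimately show ?thesis by auto
qed

end

section \<open>A place at infinity\<close>

text \<open>
Coefficients of the power series \<open>z = a + t^(p-1) z + t^(2p) z\<^sup>2\<close>. Put \<open>y = 1/t\<close>; then \<open>x = t^p z\<close> is
the branch of the curve at infinity along which \<open>x\<close> tends to \<open>0\<close>. The guards \<open>2 \<le> p\<close> make the recursion
well-founded.
\<close>
function branch_coeff :: "'a::comm_ring_1 \<Rightarrow> nat \<Rightarrow> nat \<Rightarrow> 'a" where
  "branch_coeff a p n = (if n = 0 then a
     else (if 2 \<le> p \<and> p - 1 \<le> n then branch_coeff a p (n - (p - 1)) else 0)
        + (if 2 \<le> p \<and> 2 * p \<le> n
           then \<Sum>i=0..n - 2 * p. branch_coeff a p i * branch_coeff a p (n - 2 * p - i) else 0))"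
  by auto
termination by (relation "measure (\<lambda>(a, p, n). n)") auto

declare branch_coeff.simps [simp del]

lemma branch_fps_exists:
  fixes a :: "'a::comm_ring_1"
  assumes "p \<ge> 2"
  shows "\<exists>z. fps_nth z 0 = a \<and> z = fps_const a + fps_X ^ (p - 1) * z + fps_X ^ (2 * p) * (z * z)"
proof -
  define z where "z = Abs_fps (branch_coeff a p)"
  have "fps_nth z n = fps_nth (fps_const a + fps_X ^ (p - 1) * z + fps_X ^ (2 * p) * (z * z)) n" for n
  proof -
    have "fps_nth (fps_X ^ (p - 1) * z) n = (if p - 1 \<le> n then fps_nth z (n - (p - 1)) else 0)"
      by (simp add: fps_X_power_mult_nth not_less)
    moreover have "fps_nth (fps_X ^ (2 * p) * (z * z)) n =
        (if 2 * p \<le> n then \<Sum>i=0..n - 2 * p. fps_nth z i * fps_nth z (n - 2 * p - i) else 0)"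
    proof -
      have "fps_nth (fps_X ^ (2 * p) * (z * z)) n = (if 2 * p \<le> n then fps_nth (z * z) (n - 2 * p) else 0)"
        by (simp add: fps_X_power_mult_nth not_less)
      thus ?thesis by (simp only: fps_mult_nth[of z z])
    qed
    moreover have "fps_nth z n = branch_coeff a p n" by (simp add: z_def)
    ultimately show ?thesis
      using assms by (cases "n = 0") (simp_all add: branch_coeff.simps[of a p 0] branch_coeff.simps[of a p n] z_def)
  qed
  moreover have "fps_nth z 0 = a" by (simp add: z_def branch_coeff.simps[of a p 0])
  ultimately show ?thesis by (intro exI[of _ z] conjI fps_ext)
qed

text \<open>
The term of least order cannot be cancelled by the others.
\<close>
lemma fls_sum_nonzero:
  fixes F :: "'i \<Rightarrow> 'a::comm_ring_1 fls"
  assumes "finite A" "A \<noteq> {}" "\<And>i. i \<in> A \<Longrightarrow> F i \<noteq> 0"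
    and inj: "inj_on (\<lambda>i. fls_subdegree (F i)) A"
  shows "sum F A \<noteq> 0"
proof -
  define m where "m = Min ((\<lambda>i. fls_subdegree (F i)) ` A)"
  have "m \<in> (\<lambda>i. fls_subdegree (F i)) ` A" unfolding m_def using assms by (intro Min_in) auto
  then obtain i0 where i0: "i0 \<in> A" "fls_subdegree (F i0) = m" by auto
  have z: "fls_nth (F i) m = 0" if "i \<in> A - {i0}" for i
  proof -
    have "m \<le> fls_subdegree (F i)" unfolding m_def using assms that by (intro Min_le) auto
    moreover have "m \<noteq> fls_subdegree (F i)" using inj i0 that by (auto simp: inj_on_def)
    ultimately show ?thesis by (intro fls_eq0_below_subdegree) auto
  qed
  have "sum F A = F i0 + sum F (A - {i0})" using assms i0 by (simp add: sum.remove)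
  moreover have "fls_nth (sum F (A - {i0})) m = (\<Sum>i\<in>A - {i0}. fls_nth (F i) m)" by (induction rule: infinite_finite_induct) auto
  hence "fls_nth (sum F (A - {i0})) m = 0" using z by (simp add: sum.neutral)
  ultimately have "fls_nth (sum F A) m = fls_nth (F i0) m" by simp
  also have "\<dots> \<noteq> 0" using assms(3)[OF i0(1)] i0(2) by auto
  finally show ?thesis by auto
qed

lemma abs_mult_less_imp_0:
  fixes Q k :: int
  assumes "\<bar>Q * k\<bar> < Q" shows "k = 0"
proof (rule ccontr)
  assume "k \<noteq> 0"
  hence "Q * 1 \<le> Q * \<bar>k\<bar>" using assms by (intro mult_left_mono) auto
  moreover have "Q > 0" using assms by linarith
  hence "\<bar>Q * k\<bar> = Q * \<bar>k\<bar>" by (simp add: abs_mult)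
  ultimately show False using assms by simp
qed

text \<open>
If \<open>y\<close> has a simple pole and \<open>x\<close> a pole (\<open>\<sigma> = -1\<close>) or a zero (\<open>\<sigma> = 1\<close>) of order \<open>p\<close>, then the
monomials of a window have distinct orders in an interval of length less than \<open>Q\<close>. Hence the
terms \<open>w t^Q\<close> have distinct orders too: \<open>w\<close> determines the order modulo \<open>Q\<close>.
\<close>
lemma generic_fls:
  fixes a x y :: "'a::field fls"
  assumes "kloosterman_curve p a"
    and l: "p * (2 * l + 1) = Q"
    and x: "fls_subdegree x = \<sigma> * int p" "\<bar>\<sigma>\<bar> = 1" and y: "fls_subdegree y = -1"
  shows "kloosterman_curve.generic p Q l m x y"
proof -
  interpret kloosterman_curve "TYPE('a fls)" p a by fact
  have nz: "x \<noteq> 0" "y \<noteq> 0" using x y p_gt_1 by auto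
  \<comment> \<open>The order of the monomial with number \<open>n\<close>.\<close>
  define \<nu> where "\<nu> = (\<lambda>n. \<sigma> * (int p * (n div int p)) - n mod int p)"
  have pp: "int p > 0" using p_gt_1 by simp
  have e: "xy_monomial n x y \<noteq> 0" "fls_subdegree (xy_monomial n x y) = \<nu> n" for n
    using nz x y pp by (auto simp: xy_monomial_def \<nu>_def fls_subdegree_pow algebra_simps)
  have md: "0 \<le> n mod int p" "n mod int p \<le> int p - 1" for n using pp by auto
  have \<sigma>: "\<sigma> = 1 \<or> \<sigma> = -1" using x(2) by auto
  have \<nu>_inj: "n = n'" if "\<nu> n = \<nu> n'" for n n'
  proof -
    have "int p * (\<sigma> * (n div int p - n' div int p)) = n mod int p - n' mod int p"
      using that by (simp add: \<nu>_def algebra_simps)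
    moreover have "\<bar>n mod int p - n' mod int p\<bar> < int p" using md[of n] md[of n'] by linarith
    ultimately have "\<sigma> * (n div int p - n' div int p) = 0"
      by (intro abs_mult_less_imp_0[of "int p"]) simp
    hence "n div int p = n' div int p" using \<sigma> by auto
    moreover from this that have "n mod int p = n' mod int p" by (simp add: \<nu>_def)
    ultimately show ?thesis by (metis div_mult_mod_eq)
  qed
  have \<nu>_win: "- int (p * l) - (int p - 1) \<le> \<nu> n \<and> \<nu> n \<le> int (p * l)" if "n \<in> window l" for n
  proof -
    have "\<bar>\<sigma> * (int p * (n div int p))\<bar> = int p * \<bar>n div int p\<bar>" 
      using x(2) by (simp add: abs_mult)
    also have "\<dots> \<le> int p * int l" using window_div[OF that] pp by (intro mult_left_mono) auto
    finally show ?thesis using md[of n] unfolding \<nu>_def of_nat_mult by linarith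
  qed
  have Ql: "2 * (p * l) + p = Q" using l by (simp add: algebra_simps)
  have Q: "int Q = 2 * int (p * l) + int p" unfolding Ql [symmetric] by simp
  have inj: "i = i'" if "i \<in> window l \<times> window m" "i' \<in> window l \<times> window m"
    "\<nu> (fst i) + int Q * \<nu> (snd i) = \<nu> (fst i') + int Q * \<nu> (snd i')" for i i'
  proof -
    have "\<bar>\<nu> (fst i) - \<nu> (fst i')\<bar> < int Q"
      using \<nu>_win[of "fst i"] \<nu>_win[of "fst i'"] that(1,2) unfolding Q by (auto simp: mem_Times_iff)
    moreover have "int Q * (\<nu> (snd i') - \<nu> (snd i)) = \<nu> (fst i) - \<nu> (fst i')"
      using that(3) by (simp add: algebra_simps)
    ultimately have "\<nu> (snd i') - \<nu> (snd i) = 0"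
      by (intro abs_mult_less_imp_0[of "int Q"]) simp
    with that(3) show ?thesis using \<nu>_inj by (auto intro: prod_eqI)
  qed
  show ?thesis
    unfolding generic_def
  proof (intro allI impI)
    fix d assume dS: "\<forall>i\<in>window l \<times> window m. d i \<in> Fp" and d0: "\<exists>i\<in>window l \<times> window m. d i \<noteq> 0"
    define F where "F = (\<lambda>i. d i * (xy_monomial (fst i) x y * xy_monomial (snd i) x y ^ Q))"
    define I where "I = {i \<in> window l \<times> window m. d i \<noteq> 0}"
    \<comment> \<open>Elements of the prime field are constants: \<open>d^p = d\<close> leaves only the order \<open>0\<close>.\<close>
    have dd: "fls_subdegree (d i) = 0" if "i \<in> window l \<times> window m" for i
    proof -
      have "d i ^ p = d i" using dS that by (auto simp: Fp_def)
      hence "int p * fls_subdegree (d i) = fls_subdegree (d i)" by (metis fls_subdegree_pow)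
      thus ?thesis using p_gt_1 by simp
    qed
    have F0: "F i \<noteq> 0" if "i \<in> I" for i using that e(1) by (auto simp: F_def I_def)
    have sd: "fls_subdegree (F i) = \<nu> (fst i) + int Q * \<nu> (snd i)" if "i \<in> I" for i
      using that e dd[of i] by (simp add: F_def I_def fls_subdegree_pow)
    have "sum F I \<noteq> 0"
    proof (rule fls_sum_nonzero)
      show "finite I" by (simp add: I_def)
      show "I \<noteq> {}" using d0 by (auto simp: I_def)
      show "inj_on (\<lambda>i. fls_subdegree (F i)) I"
      proof (rule inj_onI)
        fix i i' assume "i \<in> I" "i' \<in> I" "fls_subdegree (F i) = fls_subdegree (F i')"
        thus "i = i'" using inj[of i i'] sd[of i] sd[of i'] by (auto simp: I_def)
      qed
    qed (use F0 in auto)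
    moreover have "sum F (window l \<times> window m) = sum F I"
      by (rule sum.mono_neutral_right) (auto simp: I_def F_def)
    ultimately show "(\<Sum>i\<in>window l \<times> window m. d i * (xy_monomial (fst i) x y * xy_monomial (snd i) x y ^ Q)) \<noteq> 0"
      unfolding F_def by simp
  qed
qed

locale char_p_alg_closed = char_p_field ty p for ty :: "'a::alg_closed_field itself" and p +
  assumes p_odd: "odd p"
begin

definition Tr :: "nat \<Rightarrow> 'a \<Rightarrow> 'a" where "Tr n z = (\<Sum>i<n. z ^ (p ^ i))"

text \<open>
The sum telescopes because the \<open>p\<close>-power map is additive.
\<close>
lemma Tr_artin_schreier: "Tr n (y ^ p - y) = y ^ (p ^ n) - y"
proof -
  have "Tr n (y ^ p - y) = (\<Sum>i<n. y ^ (p ^ Suc i) - y ^ (p ^ i))"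
    unfolding Tr_def by (intro sum.cong) (simp_all add: frob_diff power_mult)
  also have "\<dots> = y ^ (p ^ n) - y" by (induction n) auto
  finally show ?thesis .
qed

text \<open>
The roots form a coset of the prime field.
\<close>
lemma card_artin_schreier: "finite {y. y ^ p - y = (v::'a)} \<and> card {y. y ^ p - y = v} = p"
proof -
  let ?f = "artin_schreier - [:v:]"
  have "degree ?f = p"
  proof -
    have "degree (artin_schreier + [:- v:]) = degree artin_schreier"
      by (rule degree_add_eq_left) (use degree_artin_schreier p_gt_1 in simp)
    moreover have "artin_schreier - [:v:] = artin_schreier + [:- v:]" by simp
    ultimately show ?thesis using degree_artin_schreier by (simp only:)
  qed
  then obtain y0 where "poly ?f y0 = 0"
    using alg_closed_imp_poly_has_root[of ?f] p_gt_1 by auto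
  hence y0: "y0 ^ p - y0 = v" by simp
  have "{y. y ^ p - y = v} = (\<lambda>s. y0 + s) ` Fp"
  proof (intro equalityI subsetI)
    fix y assume "y \<in> {y. y ^ p - y = v}"
    hence y: "y ^ p = v + y" by (simp add: algebra_simps)
    have "y0 ^ p = v + y0" using y0 by (simp add: algebra_simps)
    hence "(y - y0) ^ p = y - y0"
      using y frob_diff[of y y0 1] by simp
    thus "y \<in> (\<lambda>s. y0 + s) ` Fp"
      by (intro image_eqI[of _ _ "y - y0"]) (auto simp: Fp_def)
  next
    fix y assume "y \<in> (\<lambda>s. y0 + s) ` Fp"
    then obtain s where "s ^ p = s" "y = y0 + s" by (auto simp: Fp_def)
    thus "y \<in> {y. y ^ p - y = v}"
      using y0 frob_add[of y0 s 1] by simp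
  qed
  thus ?thesis using finite_Fp card_Fp by (simp add: card_image)
qed

text \<open>
Each \<open>x\<close> in the fibre carries \<open>p\<close> points of the curve \<open>y^p - y = x + a/x\<close>, and the trace condition
says \<open>y^q = y + c\<close> there. The points are counted inside the field of Laurent series, which contains
both these constant points and the generic point at infinity.
\<close>
lemma card_trace_fibre_le:
  fixes a c :: 'a
  assumes a: "a \<noteq> 0" "a \<in> Fp" and c: "c \<in> Fp" and \<mu>: "\<mu> \<ge> 1"
  defines "A \<equiv> {x. x ^ (p ^ (2 * \<mu>)) = x \<and> x \<noteq> 0 \<and> Tr (2 * \<mu>) (x + a / x) = c}"
  shows "p * card A \<le> p ^ (2 * \<mu>) + 3 * p * p ^ \<mu>"
proof -
  interpret F: kloosterman_curve "TYPE('a fls)" p "fls_const a"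
  proof
    show "prime p" by (rule prime_p)
    show "CHAR('a fls) = p" using char_p by simp
    show "fls_const a \<noteq> 0" using a by simp
    have "char_p_field TYPE('a fls) p" by unfold_locales fact+
    thus "fls_const a \<in> char_p_field.Fp p" 
      using a by (simp add: char_p_field.Fp_def Fp_def flip: fls_const_power)
  qed
  define Q where "Q = p ^ \<mu>"
  have QQ: "Q\<^sup>2 = p ^ (2 * \<mu>)" unfolding Q_def by (simp add: power_even_eq)
  \<comment> \<open>The window \<open>l\<close> has exactly \<open>Q\<close> elements; this needs \<open>Q/p\<close> to be an odd integer.\<close>
  obtain l where l: "p * (2 * l + 1) = Q"
  proof -
    have "odd (p ^ (\<mu> - 1))" using p_odd by simp
    then obtain l where "p ^ (\<mu> - 1) = 2 * l + 1" by (elim oddE)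
    moreover have "Q = p * p ^ (\<mu> - 1)" unfolding Q_def using \<mu> by (cases \<mu>) auto
    ultimately show ?thesis by (intro that[of l]) simp
  qed
  obtain z where z: "fps_nth z 0 = a" "z = fps_const a + fps_X ^ (p - 1) * z + fps_X ^ (2 * p) * (z * z)"
    using branch_fps_exists[of p a] p_gt_1 by auto
  define Z where "Z = fps_to_fls z"
  have Zeq: "Z = fls_const a + fls_X ^ (p - 1) * Z + fls_X ^ (2 * p) * (Z * Z)"
  proof -
    have "Z = fps_to_fls (fps_const a + fps_X ^ (p - 1) * z + fps_X ^ (2 * p) * (z * z))"
      unfolding Z_def by (rule arg_cong[OF z(2)])
    thus ?thesis by (simp add: Z_def fls_times_fps_to_fls fps_to_fls_power)
  qed
  \<comment> \<open>The two branches above \<open>y = 1/t\<close>: along the first \<open>x\<close> has a zero of order \<open>p\<close>, along its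
    conjugate a pole of order \<open>p\<close>.\<close>
  define x1 where "x1 = fls_X ^ p * Z"
  define y1 where "y1 = (fls_X_inv :: 'a fls)"
  define x2 where "x2 = fls_const a / x1"
  have subZ: "fls_subdegree Z = 0" "Z \<noteq> 0"
  proof -
    have "subdegree z = 0" using z(1) a by (simp add: subdegree_eq_0)
    thus "fls_subdegree Z = 0" by (simp add: Z_def fls_subdegree_fls_to_fps)
    show "Z \<noteq> 0" using z(1) a by (auto simp: Z_def)
  qed
  have sub1: "fls_subdegree x1 = 1 * int p" "x1 \<noteq> 0"
    using subZ by (auto simp: x1_def)
  have sub2: "fls_subdegree x2 = (-1) * int p"
    using sub1 a by (simp add: x2_def fls_divide_subdegree)
  have XX: "(fls_X :: 'a fls) * fls_X_inv = 1" by (simp add: fls_X_inv_conv_shift_1 fls_X_conv_shift_1 fls_shifted_times_simps)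
  have c1: "(x1, y1) \<in> F.curve"
  proof -
    have 1: "fls_X ^ p * y1 ^ p = 1" unfolding y1_def power_mult_distrib [symmetric] XX by simp
    have 2: "fls_X ^ p * y1 = fls_X ^ (p - 1)"
    proof -
      have "fls_X ^ p = fls_X ^ (p - 1) * (fls_X :: 'a fls)" 
        using p_gt_1 by (metis power_minus_mult mult.commute not_one_less_zero not_gr_zero)
      thus ?thesis by (simp add: y1_def mult.assoc XX)
    qed
    have "x1\<^sup>2 - (y1 ^ p - y1) * x1 + fls_const a
        = fls_X ^ (2 * p) * (Z * Z) - (fls_X ^ p * y1 ^ p) * Z + (fls_X ^ p * y1) * Z + fls_const a"
      unfolding x1_def mult_2 power_add by (simp add: algebra_simps power2_eq_square)
    also have "\<dots> = (fls_const a + fls_X ^ (p - 1) * Z + fls_X ^ (2 * p) * (Z * Z)) - Z"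
      unfolding 1 2 by (simp add: algebra_simps)
    also have "\<dots> = 0" using Zeq by simp
    finally show ?thesis by (simp add: F.curve_def)
  qed
  have x12: "x1 * x2 = fls_const a" using sub1 by (simp add: x2_def)
  have c2: "(x2, y1) \<in> F.curve"
  proof -
    have "x1 * x1 * (x2\<^sup>2 - (y1 ^ p - y1) * x2 + fls_const a)
        = fls_const a * (x1\<^sup>2 - (y1 ^ p - y1) * x1 + fls_const a)"
      unfolding x12 [symmetric] by (simp add: algebra_simps power2_eq_square)
    also have "\<dots> = 0" using c1 by (simp add: F.curve_def)
    finally show ?thesis using sub1 by (simp add: F.curve_def)
  qed
  have kc: "kloosterman_curve p (fls_const a)" by unfold_locales
  have g: "F.generic Q l (l + 1) x1 y1" "F.generic Q l (l + 1) x2 y1"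
    by (rule generic_fls[OF kc l sub1(1)], simp, simp add: y1_def)
       (rule generic_fls[OF kc l sub2], simp, simp add: y1_def)
  define P where "P = (SIGMA x:A. {y. y ^ p - y = x + a / x})"
  have PZ: "(\<lambda>(x, y). (fls_const x, fls_const y)) ` P \<subseteq> F.curve"
  proof safe
    fix x y assume "(x, y) \<in> P"
    hence xy: "x \<noteq> 0" "y ^ p - y = x + a / x" by (auto simp: P_def A_def)
    have "x\<^sup>2 - (y ^ p - y) * x + a = 0"
      unfolding xy(2) using xy(1) by (simp add: field_simps power2_eq_square)
    hence "fls_const (x\<^sup>2 - (y ^ p - y) * x + a) = 0" by simp
    thus "(fls_const x, fls_const y) \<in> F.curve"
      by (simp add: F.curve_def flip: fls_const_power fls_minus_const fls_plus_const fls_const_mult_const)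
  qed
  have PQ: "u ^ Q\<^sup>2 = u \<and> v ^ Q\<^sup>2 = v + fls_const c"
    if "(u, v) \<in> (\<lambda>(x, y). (fls_const x, fls_const y)) ` P" for u v
  proof -
    from that obtain x y where uv: "u = fls_const x" "v = fls_const y" and "(x, y) \<in> P" by auto
    hence xy: "x ^ p ^ (2 * \<mu>) = x" "Tr (2 * \<mu>) (x + a / x) = c" "y ^ p - y = x + a / x"
      by (auto simp: P_def A_def)
    have "y ^ (p ^ (2 * \<mu>)) = y + c"
      using Tr_artin_schreier[of "2 * \<mu>" y] xy(2,3) by (simp add: algebra_simps)
    thus ?thesis unfolding uv QQ using xy(1)
      by (simp add: fls_plus_const flip: fls_const_power)
  qed
  have "fls_const c \<in> F.Fp" using c by (simp add: F.Fp_def Fp_def flip: fls_const_power)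
  from F.card_rational_points_le[OF Q_def l c1 c2 x12 g this PZ PQ]
  have fin: "finite ((\<lambda>(x, y). (fls_const x, fls_const y)) ` P)"
    and le: "card ((\<lambda>(x, y). (fls_const x, fls_const y)) ` P) \<le> Q\<^sup>2 + 3 * p * Q"
    by auto
  have inj: "inj_on (\<lambda>(x, y). (fls_const x, fls_const y)) P"
  proof -
    have "x = x'" if "fls_const x = fls_const x'" for x x' :: 'a
      using that by (metis fls_const_nth)
    thus ?thesis by (auto simp: inj_on_def)
  qed
  have finA: "finite A"
  proof (rule finite_subset)
    have "p ^ (2 * \<mu>) > 1" using p_gt_1 \<mu> by (intro one_less_power) auto
    hence "degree (monom 1 (p ^ (2 * \<mu>)) - monom 1 1 :: 'a poly) = p ^ (2 * \<mu>)"
      by (rule degree_monom_minus_X)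
    hence "(monom 1 (p ^ (2 * \<mu>)) - monom 1 1 :: 'a poly) \<noteq> 0"
      using p_gt_1 by auto
    from poly_roots_finite[OF this] show "finite {x::'a. x ^ p ^ (2 * \<mu>) = x}"
      by (simp add: poly_monom)
  qed (auto simp: A_def)
  have "card ((\<lambda>(x, y). (fls_const x, fls_const y)) ` P) = card P"
    by (rule card_image[OF inj])
  also have "\<dots> = (\<Sum>x\<in>A. card {y. y ^ p - y = x + a / x})"
    unfolding P_def using finA card_artin_schreier by (intro card_SigmaI) auto
  also have "\<dots> = p * card A" using card_artin_schreier by simp
  finally show ?thesis using le unfolding QQ by (simp add: Q_def)
qed

end

section \<open>The bound for Kloosterman sums over finite fields\<close>

text \<open>
Over an algebraically closed field a polynomial without common root with its derivative has as
many roots as its degree.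
\<close>
lemma card_simple_roots:
  fixes f :: "'a::alg_closed_field poly"
  assumes "f \<noteq> 0" "\<And>x. poly f x = 0 \<Longrightarrow> poly (pderiv f) x \<noteq> 0"
  shows "card {x. poly f x = 0} = degree f"
  using assms
proof (induction "degree f" arbitrary: f)
  case 0
  then obtain c where "f = [:c:]" by (metis degree_eq_zeroE)
  thus ?case using 0 by auto
next
  case (Suc d)
  obtain x where x: "poly f x = 0"
    using alg_closed_imp_poly_has_root[of f] Suc.hyps(2) by auto
  then obtain g where f: "f = [:-x, 1:] * g" by (metis poly_eq_0_iff_dvd dvdE)
  have g0: "g \<noteq> 0" using f Suc.prems(1) by auto
  have dg: "degree f = Suc (degree g)" unfolding f using g0 by (subst degree_mult_eq) auto
  have pd: "poly (pderiv f) y = poly g y + (y - x) * poly (pderiv g) y" for y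
    unfolding f pderiv_mult poly_add poly_mult by (simp add: pderiv_pCons)
  have gx: "poly g x \<noteq> 0" using Suc.prems(2)[OF x] pd[of x] by simp
  have "card {y. poly g y = 0} = degree g"
  proof (rule Suc.hyps(1))
    fix y assume y: "poly g y = 0"
    hence "poly f y = 0" by (simp add: f)
    from Suc.prems(2)[OF this] show "poly (pderiv g) y \<noteq> 0" using pd[of y] y by auto
  qed (use dg Suc.hyps(2) g0 in auto)
  moreover have "{y. poly f y = 0} = insert x {y. poly g y = 0}" by (auto simp: f)
  ultimately show ?case using gx dg poly_roots_finite[OF g0] by simp
qed

context char_p_alg_closed
begin

definition GF :: "nat \<Rightarrow> 'a set" where "GF n = {x. x ^ (p ^ n) = x}"

lemma GF_0: "0 \<in> GF n" and GF_1: "1 \<in> GF n"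
  using p_gt_1 by (auto simp: GF_def)
lemma GF_add: "x \<in> GF n \<Longrightarrow> y \<in> GF n \<Longrightarrow> x + y \<in> GF n"
  by (simp add: GF_def frob_add)
lemma GF_diff: "x \<in> GF n \<Longrightarrow> y \<in> GF n \<Longrightarrow> x - y \<in> GF n"
  by (simp add: GF_def frob_diff)
lemma GF_uminus: "x \<in> GF n \<Longrightarrow> - x \<in> GF n"
  using GF_diff[of 0 n x] GF_0 by simp
lemma GF_mult: "x \<in> GF n \<Longrightarrow> y \<in> GF n \<Longrightarrow> x * y \<in> GF n"
  by (simp add: GF_def power_mult_distrib)
lemma GF_divide: "x \<in> GF n \<Longrightarrow> y \<in> GF n \<Longrightarrow> x / y \<in> GF n"
  by (simp add: GF_def power_divide)
lemma Fp_subset_GF: "Fp \<subseteq> GF n"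
  using Fp_pow by (auto simp: GF_def)
lemma GF_one_eq: "GF 1 = Fp"
  by (simp add: GF_def Fp_def)
lemma GF_double: "x \<in> GF n \<Longrightarrow> x \<in> GF (2 * n)"
  by (simp add: GF_def mult_2 power_add power_mult)

lemma finite_GF: "n > 0 \<Longrightarrow> finite (GF n)" and card_GF: "n > 0 \<Longrightarrow> card (GF n) = p ^ n"
proof -
  assume n: "n > 0"
  define f :: "'a poly" where "f = monom 1 (p ^ n) - monom 1 1"
  have q1: "p ^ n > 1" using p_gt_1 n by (intro one_less_power) auto
  have deg: "degree f = p ^ n" unfolding f_def by (rule degree_monom_minus_X[OF q1])
  have f0: "f \<noteq> 0" using deg q1 degree_0 by (metis not_one_less_zero)
  have roots: "GF n = {x. poly f x = 0}" by (auto simp: GF_def f_def poly_monom)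
  have "of_nat (p ^ n) = (0 :: 'a)"
    using n char_p by (subst of_nat_eq_0_iff_char_dvd) auto
  hence "pderiv f = - 1"
    by (simp add: f_def pderiv_diff pderiv_monom monom_0 one_pCons del: of_nat_power)
  hence "card {x. poly f x = 0} = degree f"
    by (intro card_simple_roots f0) simp
  thus "card (GF n) = p ^ n" using deg roots by simp
  show "finite (GF n)" unfolding roots by (rule poly_roots_finite[OF f0])
qed

lemma Tr_add: "Tr n (x + y) = Tr n x + Tr n y"
  by (simp add: Tr_def frob_add sum.distrib)

lemma Tr_0: "Tr n 0 = 0"
  using p_gt_1 by (auto simp: Tr_def power_0_left)

lemma Tr_1 [simp]: "Tr 1 z = z"
  by (simp add: Tr_def)

lemma Tr_in_Fp: "z \<in> GF n \<Longrightarrow> Tr n z \<in> Fp"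
proof -
  assume z: "z \<in> GF n"
  have "Tr n z ^ p - Tr n z = (\<Sum>i<n. z ^ (p ^ Suc i) - z ^ (p ^ i))"
    using frob_sum[of "\<lambda>i. z ^ (p ^ i)" "{..<n}" 1]
    by (simp add: Tr_def sum_subtractf flip: power_mult) (simp add: mult.commute)
  also have "\<dots> = z ^ (p ^ n) - z" by (induction n) auto
  finally show ?thesis using z by (simp add: Fp_def GF_def)
qed

lemma Tr_double: "Tr (2 * n) z = Tr n (z + z ^ (p ^ n))"
proof -
  have "Tr (n + m) z = Tr n z + (\<Sum>i<m. z ^ (p ^ (n + i)))" for m
    by (induction m) (auto simp: Tr_def)
  hence "Tr (2 * n) z = Tr n z + (\<Sum>i<n. z ^ (p ^ (n + i)))" by (simp add: mult_2)
  also have "(\<Sum>i<n. z ^ (p ^ (n + i))) = Tr n (z ^ (p ^ n))"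
    by (simp add: Tr_def power_add power_mult)
  finally show ?thesis by (simp add: Tr_add)
qed

text \<open>
The trace is a nonzero polynomial of degree less than the number of elements of the field.
\<close>
lemma Tr_not_all_zero: "n > 0 \<Longrightarrow> \<exists>z\<in>GF n. Tr n z \<noteq> 0"
proof (rule ccontr)
  assume n: "n > 0" and "\<not> (\<exists>z\<in>GF n. Tr n z \<noteq> 0)"
  define f :: "'a poly" where "f = (\<Sum>i<n. monom 1 (p ^ i))"
  have "poly f z = Tr n z" for z by (simp add: f_def Tr_def poly_sum poly_monom)
  hence sub: "GF n \<subseteq> {z. poly f z = 0}" using \<open>\<not> _\<close> by auto
  have "coeff f 1 = (\<Sum>i<n. if i = 0 then 1 else 0)"
    unfolding f_def coeff_sum using p_gt_1 by (intro sum.cong) auto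
  also have "\<dots> = 1" using n by simp
  finally have f0: "f \<noteq> 0" by auto
  have "degree f \<le> p ^ (n - 1)"
    unfolding f_def using p_gt_1
    by (intro degree_sum_le) (auto intro!: order.trans[OF degree_monom_le] power_increasing)
  also have "\<dots> < p ^ n" using p_gt_1 n by (intro power_strict_increasing) auto
  finally have "degree f < card (GF n)" using card_GF n by simp
  also have "\<dots> \<le> card {z. poly f z = 0}"
    by (rule card_mono[OF poly_roots_finite[OF f0] sub])
  also have "\<dots> \<le> degree f" by (rule card_poly_roots_bound[OF f0])
  finally show False by simp
qed

text \<open>
The additive character \<open>n \<mapsto> exp (2 \<pi> i n / p)\<close> on the prime field. The value does not depend
on which representative \<open>SOME\<close> picks.
\<close>
definition chi :: "'a \<Rightarrow> complex" where
  "chi z = cis (2 * pi * real (SOME k. of_nat k = z) / real p)"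

lemma cis_mod: "cis (2 * pi * real (k mod p) / real p) = cis (2 * pi * real k / real p)"
proof -
  have "real k = real (k mod p) + real p * real (k div p)"
    by (metis mod_mult_div_eq of_nat_add of_nat_mult)
  hence "2 * pi * real k / real p = 2 * pi * real (k mod p) / real p + 2 * pi * real (k div p)"
    using p_gt_1 by (simp add: field_simps)
  also have "cis \<dots> = cis (2 * pi * real (k mod p) / real p)"
    by (simp flip: cis_mult)
  finally show ?thesis by simp
qed

lemma chi_of_nat: "chi (of_nat k) = cis (2 * pi * real k / real p)"
proof -
  define j where "j = (SOME j. of_nat j = (of_nat k :: 'a))"
  have "of_nat j = (of_nat k :: 'a)" unfolding j_def by (rule someI[of _ k]) simp
  hence "j mod p = k mod p" by (simp add: of_nat_eq_iff_cong_CHAR char_p cong_def)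
  hence "cis (2 * pi * real j / real p) = cis (2 * pi * real k / real p)"
    using cis_mod[of j] cis_mod[of k] by simp
  thus ?thesis by (simp add: chi_def j_def)
qed

lemma chi_0 [simp]: "chi 0 = 1"
  using chi_of_nat[of 0] by simp

lemma chi_add: "x \<in> Fp \<Longrightarrow> y \<in> Fp \<Longrightarrow> chi (x + y) = chi x * chi y"
proof -
  assume "x \<in> Fp" "y \<in> Fp"
  then obtain i j where "x = of_nat i" "y = of_nat j" unfolding Fp_eq by auto
  thus ?thesis using chi_of_nat[of "i + j"]
    by (simp add: chi_of_nat cis_mult add_divide_distrib distrib_left)
qed

lemma norm_chi [simp]: "norm (chi z) = 1"
  by (simp add: chi_def)

lemma chi_uminus: "x \<in> Fp \<Longrightarrow> chi (- x) = cnj (chi x)"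
proof -
  assume x: "x \<in> Fp"
  have 1: "chi (- x) * chi x = 1" using chi_add[OF Fp_uminus[OF x] x] by simp
  have 2: "chi x * cnj (chi x) = 1"
    using norm_chi[of x] by (simp add: complex_mult_cnj cmod_power2 [symmetric] flip: complex_norm_square)
  have "chi (- x) = chi (- x) * (chi x * cnj (chi x))" by (simp add: 2)
  also have "\<dots> = cnj (chi x)" using 1 by (simp add: mult.assoc [symmetric])
  finally show ?thesis .
qed

lemma chi_neq_1: "x \<in> Fp \<Longrightarrow> x \<noteq> 0 \<Longrightarrow> chi x \<noteq> 1"
proof
  assume x: "x \<in> Fp" "x \<noteq> 0" "chi x = 1"
  then obtain k where k: "x = of_nat k" "k < p" unfolding Fp_eq by auto
  have "cos (2 * pi * real k / real p) = 1"
    using x(3) unfolding k chi_of_nat by (simp add: complex_eq_iff)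
  then obtain m :: int where "2 * pi * real k / real p = of_int m * 2 * pi"
    using cos_one_2pi_int by auto
  hence "real k = of_int m * real p" using p_gt_1 by (simp add: field_simps)
  hence "int k = m * int p" by (metis of_int_eq_iff of_int_mult of_int_of_nat_eq)
  hence "p dvd k" by (metis dvd_triv_right of_nat_dvd_iff)
  thus False using k x(2) by (auto dest: dvd_imp_le)
qed

text \<open>
The additive character of the field with \<open>p^n\<close> elements induced by \<open>chi\<close>. It is meant to be used on
\<open>GF n\<close>, where the trace takes values in the prime field.
\<close>
definition psi :: "nat \<Rightarrow> 'a \<Rightarrow> complex" where "psi n z = chi (Tr n z)"

lemma psi_add: "x \<in> GF n \<Longrightarrow> y \<in> GF n \<Longrightarrow> psi n (x + y) = psi n x * psi n y"
  by (simp add: psi_def Tr_add chi_add Tr_in_Fp)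

lemma psi_0 [simp]: "psi n 0 = 1"
  by (simp add: psi_def Tr_0)

text \<open>
Orthogonality: shifting by an element where the character is not \<open>1\<close> multiplies the sum by that
value.
\<close>
lemma sum_psi_zero: "n > 0 \<Longrightarrow> (\<Sum>s\<in>GF n. psi n s) = 0"
proof -
  assume n: "n > 0"
  obtain s0 where s0: "s0 \<in> GF n" "Tr n s0 \<noteq> 0" using Tr_not_all_zero[OF n] by blast
  hence ne: "psi n s0 \<noteq> 1" using chi_neq_1 Tr_in_Fp by (simp add: psi_def)
  have "(\<Sum>s\<in>GF n. psi n s) = (\<Sum>s\<in>GF n. psi n (s0 + s))"
    by (rule sum.reindex_bij_witness[of _ "\<lambda>s. s0 + s" "\<lambda>s. s - s0"])
       (auto intro: GF_add GF_diff s0)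
  also have "\<dots> = psi n s0 * (\<Sum>s\<in>GF n. psi n s)"
    unfolding sum_distrib_left by (intro sum.cong refl psi_add s0)
  finally have "(1 - psi n s0) * (\<Sum>s\<in>GF n. psi n s) = 0" by (simp add: algebra_simps)
  thus ?thesis using ne by simp
qed

lemma sum_psi_mult:
  assumes "n > 0" "u \<in> GF n"
  shows "(\<Sum>s\<in>GF n. psi n (s * u)) = (if u = 0 then of_nat (p ^ n) else 0)"
proof (cases "u = 0")
  case False
  have "(\<Sum>s\<in>GF n. psi n (s * u)) = (\<Sum>s\<in>GF n. psi n s)"
    by (rule sum.reindex_bij_witness[of _ "\<lambda>s. s / u" "\<lambda>s. s * u"])
       (use False assms in \<open>auto intro: GF_mult GF_divide\<close>)
  thus ?thesis using False sum_psi_zero[OF assms(1)] by simp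
qed (use assms card_GF in simp)

definition Kl :: "nat \<Rightarrow> 'a \<Rightarrow> complex" where
  "Kl n a = (\<Sum>x\<in>GF n - {0}. psi n (x + a / x))"

text \<open>
The substitution \<open>x \<mapsto> -x\<close> conjugates the sum.
\<close>
lemma Kl_real: 
  assumes a: "a \<in> GF n"
  shows "Kl n a \<in> \<real>"
proof -
  have "cnj (Kl n a) = (\<Sum>x\<in>GF n - {0}. psi n (- x + a / (- x)))"
    unfolding Kl_def cnj_sum
  proof (rule sum.cong)
    fix x assume "x \<in> GF n - {0}"
    hence x: "x + a / x \<in> GF n" using a by (auto intro: GF_add GF_divide)
    have "Tr n (- (x + a / x)) = - Tr n (x + a / x)"
      using Tr_add[of n "x + a / x" "- (x + a / x)"] by (simp add: Tr_0 eq_neg_iff_add_eq_0 add.commute)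
    thus "cnj (psi n (x + a / x)) = psi n (- x + a / (- x))"
      using chi_uminus[OF Tr_in_Fp[OF x]] by (simp add: psi_def)
  qed simp
  also have "\<dots> = Kl n a"
    unfolding Kl_def
    by (rule sum.reindex_bij_witness[of _ uminus uminus]) (auto intro: GF_uminus)
  finally show ?thesis by (simp add: Reals_cnj_iff)
qed

text \<open>
The polynomial \<open>X\<^sup>2 - s X + t\<close> over the field with \<open>q\<close> elements has its roots in that field or in its
quadratic extension. The elements \<open>z\<close> counted first are the roots whose conjugate \<open>z^q\<close> is the other
root; the pairs counted second are the ordered factorisations over the small field. Distinct
roots in the small field give \<open>0 + 2\<close>, a double root gives \<open>1 + 1\<close>, and conjugate roots give \<open>2 + 0\<close>.
\<close>
lemma card_quadratic:
  assumes n: "n > 0" and s: "s \<in> GF n" and t: "t \<in> GF n" "t \<noteq> 0"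
  shows "card {z \<in> GF (2 * n) - {0}. (z + z ^ (p ^ n), z * z ^ (p ^ n)) = (s, t)}
       + card {xy \<in> (GF n - {0}) \<times> (GF n - {0}). (fst xy + snd xy, fst xy * snd xy) = (s, t)} = 2"
    (is "card ?Z + card ?P = 2")
proof -
  define q where "q = p ^ n"
  obtain r where "poly [:t, -s, 1:] r = 0"
    using alg_closed_imp_poly_has_root[of "[:t, -s, 1:]"] by auto
  define r' where "r' = s - r"
  have t_eq: "r * r' = t"
    using \<open>poly _ r = 0\<close> by (simp add: r'_def algebra_simps eq_neg_iff_add_eq_0)
  have root: "z = r \<or> z = r'" if "z * (s - z) = t" for z
  proof -
    have "(z - r) * (z - r') = 0"
      using that t_eq by (simp add: r'_def algebra_simps)
    thus ?thesis by auto
  qed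
  have sq: "s ^ q = s" and tq: "t ^ q = t" using s t by (auto simp: GF_def q_def)
  have r'q: "r' ^ q = s - r ^ q" unfolding r'_def q_def frob_diff using sq by (simp add: q_def)
  have "r ^ q * (s - r ^ q) = t"
    using arg_cong[OF t_eq, of "\<lambda>x. x ^ q"] r'q tq by (simp add: power_mult_distrib)
  hence rq: "r ^ q = r \<or> r ^ q = r'" by (rule root)
  have nz: "r \<noteq> 0" "r' \<noteq> 0" using t_eq t by auto
  have qq: "p ^ (2 * n) = q * q" by (simp add: q_def mult_2 power_add)
  have Zr: "z = r \<or> z = r'" "s - z = z ^ q" if "z \<in> ?Z" for z
  proof -
    have "z * (s - z) = t" "s - z = z ^ q" using that by (auto simp: q_def)
    thus "z = r \<or> z = r'" "s - z = z ^ q" using root by auto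
  qed
  have Pr: "fst xy = r \<or> fst xy = r'" "snd xy = s - fst xy" if "xy \<in> ?P" for xy
  proof -
    have "fst xy * (s - fst xy) = t" "snd xy = s - fst xy" using that by auto
    thus "fst xy = r \<or> fst xy = r'" "snd xy = s - fst xy" using root by auto
  qed
  have sm: "r + r' = s" "r' + r = s" "r * r' = t" "r' * r = t"
    using t_eq by (simp_all add: r'_def mult.commute)
  have sr: "s - r = r'" "s - r' = r" by (simp_all add: r'_def)
  show ?thesis
  proof (cases "r ^ q = r")
    case True
    have rF: "r \<in> GF n" "r' \<in> GF n" using True r'q by (auto simp: GF_def r'_def q_def)
    have P: "?P = {(r, r'), (r', r)}"
    proof
      show "?P \<subseteq> {(r, r'), (r', r)}"
      proof
        fix xy assume "xy \<in> ?P"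
        from Pr[OF this] show "xy \<in> {(r, r'), (r', r)}" by (cases xy) (auto simp: sr)
      qed
      show "{(r, r'), (r', r)} \<subseteq> ?P"
        using rF nz sm by simp
    qed
    show ?thesis
    proof (cases "r = r'")
      case rr: True
      have Z: "?Z = {r}"
      proof
        show "?Z \<subseteq> {r}" using Zr(1) unfolding rr [symmetric] by blast
        show "{r} \<subseteq> ?Z"
          using GF_double[OF rF(1)] nz sm True unfolding rr [symmetric] q_def by simp
      qed
      show ?thesis unfolding P Z using rr by simp
    next
      case rr: False
      have Z: "?Z = {}"
      proof (rule ccontr)
        assume "?Z \<noteq> {}"
        then obtain z where z: "z \<in> ?Z" by blast
        have "z ^ q = z" using Zr(1)[OF z] True r'q sr by auto
        hence "s - z = z" using Zr(2)[OF z] by simp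
        thus False using Zr(1)[OF z] rr sr by auto
      qed
      show ?thesis unfolding P Z using rr by simp
    qed
  next
    case False
    hence rq': "r ^ q = r'" "r' ^ q = r" using rq r'q by (auto simp: r'_def)
    have P: "?P = {}"
    proof (rule ccontr)
      assume "?P \<noteq> {}"
      then obtain xy where xy: "xy \<in> ?P" by blast
      have "fst xy ^ q = fst xy" using xy by (auto simp: GF_def q_def)
      thus False using Pr(1)[OF xy] rq' False by auto
    qed
    have Z: "?Z = {r, r'}"
    proof
      show "?Z \<subseteq> {r, r'}" using Zr(1) by blast
      have "r \<in> GF (2 * n)" "r' \<in> GF (2 * n)" 
        unfolding GF_def qq using rq' by (simp_all add: power_mult)
      thus "{r, r'} \<subseteq> ?Z"
        using nz sm rq' unfolding q_def by simp
    qed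
    show ?thesis unfolding P Z using False rq' by simp
  qed
qed

text \<open>
Both \<open>K\<^bsub>q\<^sup>2\<^esub>\<close> and \<open>K\<^sub>q\<^sup>2\<close> are sums of \<open>\<psi>(s (1 + a/t))\<close>: over elements with trace \<open>s\<close> and norm \<open>t\<close> in the
first case, over pairs with sum \<open>s\<close> and product \<open>t\<close> in the second. By \<open>card_quadratic\<close> each
\<open>(s, t)\<close> is counted twice in total, and summing over \<open>s\<close> leaves only \<open>t = -a\<close>.
\<close>
lemma Kl_double:
  assumes n: "n > 0" and a: "a \<in> GF n" "a \<noteq> 0"
  shows "Kl (2 * n) a = 2 * of_nat (p ^ n) - (Kl n a)\<^sup>2"
proof -
  define q where "q = p ^ n"
  define F where "F = GF n"
  define G where "G = (\<lambda>(s, t). psi n (s * (1 + a / t)))"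
  define Z where "Z = GF (2 * n) - {0}"
  define P where "P = (F - {0}) \<times> (F - {0})"
  define ST where "ST = F \<times> (F - {0})"
  define \<zeta> where "\<zeta> = (\<lambda>z::'a. (z + z ^ q, z * z ^ q))"
  define \<pi> where "\<pi> = (\<lambda>xy::'a \<times> 'a. (fst xy + snd xy, fst xy * snd xy))"
  have fin: "finite Z" "finite P" "finite ST" "finite F"
    using n finite_GF by (auto simp: Z_def P_def ST_def F_def)
  have qq: "p ^ (2 * n) = q * q" by (simp add: q_def mult_2 power_add)
  have aq: "a ^ q = a" using a by (simp add: GF_def q_def)
  have K1: "(Kl n a)\<^sup>2 = (\<Sum>xy\<in>P. G (\<pi> xy))"
  proof -
    have "(Kl n a)\<^sup>2 = (\<Sum>x\<in>F - {0}. \<Sum>y\<in>F - {0}. psi n (x + a / x) * psi n (y + a / y))"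
      by (simp add: Kl_def F_def power2_eq_square sum_product)
    also have "\<dots> = (\<Sum>(x, y)\<in>P. psi n (x + a / x) * psi n (y + a / y))"
      by (simp add: P_def sum.cartesian_product)
    also have "\<dots> = (\<Sum>xy\<in>P. G (\<pi> xy))"
    proof (rule sum.cong)
      fix xy assume xy: "xy \<in> P"
      obtain x y where [simp]: "xy = (x, y)" by (cases xy)
      have xy: "x \<in> F" "y \<in> F" "x \<noteq> 0" "y \<noteq> 0" using xy by (auto simp: P_def)
      have "psi n (x + a / x) * psi n (y + a / y) = psi n ((x + a / x) + (y + a / y))"
        using xy a by (intro psi_add [symmetric] GF_add GF_divide) (auto simp: F_def)
      also have "(x + a / x) + (y + a / y) = (x + y) * (1 + a / (x * y))"
        using xy by (simp add: field_simps)
      finally show "(case xy of (x, y) \<Rightarrow> psi n (x + a / x) * psi n (y + a / y)) = G (\<pi> xy)"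
        by (simp add: G_def \<pi>_def)
    qed simp
    finally show ?thesis .
  qed
  have K2: "Kl (2 * n) a = (\<Sum>z\<in>Z. G (\<zeta> z))"
    unfolding Kl_def Z_def
  proof (rule sum.cong)
    fix z assume z: "z \<in> GF (2 * n) - {0}"
    have "psi (2 * n) (z + a / z) = psi n ((z + a / z) + (z + a / z) ^ q)"
      by (simp add: psi_def Tr_double q_def)
    also have "(z + a / z) ^ q = z ^ q + a / z ^ q"
      unfolding q_def frob_add using aq by (simp add: power_divide q_def)
    also have "(z + a / z) + (z ^ q + a / z ^ q) = (z + z ^ q) * (1 + a / (z * z ^ q))"
      using z by (simp add: field_simps)
    finally show "psi (2 * n) (z + a / z) = G (\<zeta> z)" by (simp add: G_def \<zeta>_def)
  qed simp
  have \<zeta>: "\<zeta> ` Z \<subseteq> ST"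
  proof (rule image_subsetI)
    fix z assume z: "z \<in> Z"
    hence zq: "(z ^ q) ^ q = z" "z \<noteq> 0" unfolding Z_def GF_def qq by (simp_all add: power_mult)
    have "(z + z ^ q) ^ q = z + z ^ q" using frob_add[of z "z ^ q" n] zq by (simp add: q_def add.commute)
    moreover have "(z * z ^ q) ^ q = z * z ^ q" using zq by (simp add: power_mult_distrib mult.commute)
    ultimately show "\<zeta> z \<in> ST" using zq by (auto simp: ST_def F_def \<zeta>_def GF_def q_def)
  qed
  have \<pi>: "\<pi> ` P \<subseteq> ST"
    by (auto simp: P_def ST_def \<pi>_def F_def intro: GF_add GF_mult)
  have "(\<Sum>z\<in>Z. G (\<zeta> z)) = (\<Sum>st\<in>ST. \<Sum>z\<in>{z\<in>Z. \<zeta> z = st}. G (\<zeta> z))"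
    using sum.group[OF fin(1,3) \<zeta>, of "\<lambda>z. G (\<zeta> z)"] by simp
  also have "\<dots> = (\<Sum>st\<in>ST. of_nat (card {z\<in>Z. \<zeta> z = st}) * G st)"
    by (intro sum.cong) auto
  finally have 1: "(\<Sum>z\<in>Z. G (\<zeta> z)) = \<dots>" .
  have "(\<Sum>xy\<in>P. G (\<pi> xy)) = (\<Sum>st\<in>ST. \<Sum>xy\<in>{xy\<in>P. \<pi> xy = st}. G (\<pi> xy))"
    using sum.group[OF fin(2,3) \<pi>, of "\<lambda>z. G (\<pi> z)"] by simp
  also have "\<dots> = (\<Sum>st\<in>ST. of_nat (card {xy\<in>P. \<pi> xy = st}) * G st)"
    by (intro sum.cong) auto
  finally have 2: "(\<Sum>xy\<in>P. G (\<pi> xy)) = \<dots>" .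
  have cnt: "card {z\<in>Z. \<zeta> z = st} + card {xy\<in>P. \<pi> xy = st} = 2" if st: "st \<in> ST" for st
  proof -
    obtain s t where [simp]: "st = (s, t)" by (cases st)
    have "s \<in> GF n" "t \<in> GF n" "t \<noteq> 0" using st by (auto simp: ST_def F_def)
    from card_quadratic[OF n this] show ?thesis by (simp add: Z_def P_def F_def \<zeta>_def \<pi>_def q_def)
  qed
  have "Kl (2 * n) a + (Kl n a)\<^sup>2 
      = (\<Sum>st\<in>ST. of_nat (card {z\<in>Z. \<zeta> z = st} + card {xy\<in>P. \<pi> xy = st}) * G st)"
    unfolding K1 K2 1 2 by (simp add: sum.distrib algebra_simps)
  also have "\<dots> = (\<Sum>st\<in>ST. 2 * G st)"
    by (rule sum.cong) (simp_all only: cnt of_nat_numeral)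
  also have "\<dots> = 2 * (\<Sum>s\<in>F. \<Sum>t\<in>F - {0}. psi n (s * (1 + a / t)))"
    by (simp add: G_def ST_def sum.cartesian_product sum_distrib_left)
  also have "(\<Sum>s\<in>F. \<Sum>t\<in>F - {0}. psi n (s * (1 + a / t)))
      = (\<Sum>t\<in>F - {0}. \<Sum>s\<in>F. psi n (s * (1 + a / t)))"
    by (rule sum.swap)
  also have "\<dots> = (\<Sum>t\<in>F - {0}. if t = - a then of_nat (p ^ n) else 0)"
  proof (rule sum.cong)
    fix t assume t: "t \<in> F - {0}"
    have "1 + a / t \<in> GF n" using t a by (auto simp: F_def intro: GF_add GF_1 GF_divide)
    moreover have "1 + a / t = 0 \<longleftrightarrow> t = - a"
      using t by (auto simp: field_simps add_eq_0_iff)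
    ultimately show "(\<Sum>s\<in>F. psi n (s * (1 + a / t))) = (if t = - a then of_nat (p ^ n) else 0)"
      using sum_psi_mult[OF n] by (simp add: F_def)
  qed simp
  also have "\<dots> = of_nat (p ^ n)"
    using fin a by (simp add: F_def GF_uminus)
  finally show ?thesis by (simp add: algebra_simps)
qed

text \<open>
Group the terms by the trace \<open>c\<close> of \<open>x + a/x\<close>. Each fibre has at most \<open>B = q/p + 3 \<surd>q\<close> elements. The
character sums to \<open>0\<close> over all \<open>c\<close>, so \<open>- K\<close> equals the sum of the nonnegative defects \<open>B - N(c)\<close>
weighted by real parts at most \<open>1\<close>, and the defects add up to \<open>3 p \<surd>q + 1\<close>.
\<close>
lemma Kl_lower_bound:
  assumes a: "a \<in> Fp" "a \<noteq> 0" and \<mu>: "\<mu> \<ge> 1"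
  shows "- Re (Kl (2 * \<mu>) a) \<le> 3 * real p * real p ^ \<mu> + 1"
proof -
  define n where "n = 2 * \<mu>"
  have n: "n > 0" using \<mu> by (simp add: n_def)
  define fib where "fib = (\<lambda>c. {x \<in> GF n - {0}. Tr n (x + a / x) = c})"
  define N where "N = (\<lambda>c. card (fib c))"
  define B where "B = real p ^ n / real p + 3 * real p ^ \<mu>"
  have pp: "real p > 0" using p_gt_1 by simp
  have pB: "real p * B = real p ^ n + 3 * real p * real p ^ \<mu>"
    using pp by (simp add: B_def distrib_left)
  have NB: "real (N c) \<le> B" if "c \<in> Fp" for c
  proof -
    have "p * N c \<le> p ^ n + 3 * p * p ^ \<mu>"
      using card_trace_fibre_le[OF a(2,1) that \<mu>] unfolding N_def fib_def n_def GF_def by simp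
    hence "real (p * N c) \<le> real (p ^ n + 3 * p * p ^ \<mu>)" by (rule of_nat_mono)
    also have "\<dots> = real p * B" using pp by (simp add: pB)
    finally show ?thesis using pp by simp
  qed
  have aG: "a \<in> GF n" using a Fp_subset_GF by auto
  have im: "(\<lambda>x. Tr n (x + a / x)) ` (GF n - {0}) \<subseteq> Fp"
    using aG by (auto intro!: Tr_in_Fp GF_add GF_divide)
  have fG: "finite (GF n - {0})" using finite_GF[OF n] by simp
  have sumN: "(\<Sum>c\<in>Fp. real (N c)) = real p ^ n - 1"
  proof -
    have "(\<Sum>c\<in>Fp. N c) = card (GF n - {0})"
      unfolding N_def fib_def card_eq_sum by (rule sum.group[OF fG finite_Fp im])
    also have "\<dots> = p ^ n - 1" using card_GF[OF n] GF_0 finite_GF[OF n] by simp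
    finally have "real (\<Sum>c\<in>Fp. N c) = real (p ^ n - 1)" by simp
    thus ?thesis using p_gt_1 by (simp add: of_nat_diff)
  qed
  have "Kl n a = (\<Sum>c\<in>Fp. \<Sum>x\<in>fib c. psi n (x + a / x))"
    unfolding Kl_def fib_def by (rule sum.group[OF fG finite_Fp im, symmetric])
  also have "\<dots> = (\<Sum>c\<in>Fp. of_nat (N c) * chi c)"
  proof (rule sum.cong)
    fix c
    have "(\<Sum>x\<in>fib c. psi n (x + a / x)) = (\<Sum>x\<in>fib c. chi c)"
      by (rule sum.cong) (auto simp: psi_def fib_def)
    thus "(\<Sum>x\<in>fib c. psi n (x + a / x)) = of_nat (N c) * chi c" by (simp add: N_def)
  qed simp
  finally have K: "Re (Kl n a) = (\<Sum>c\<in>Fp. real (N c) * Re (chi c))" by simp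
  have "(\<Sum>c\<in>Fp. chi c) = 0"
    using sum_psi_zero[of 1] by (simp add: GF_one_eq psi_def flip: One_nat_def)
  hence s0: "(\<Sum>c\<in>Fp. Re (chi c)) = 0" by (metis Re_sum zero_complex.simps(1))
  have "- Re (Kl n a) = (\<Sum>c\<in>Fp. (B - real (N c)) * Re (chi c))"
    unfolding K using s0 by (simp add: algebra_simps sum_subtractf flip: sum_distrib_left)
  also have "\<dots> \<le> (\<Sum>c\<in>Fp. (B - real (N c)) * 1)"
  proof (intro sum_mono mult_left_mono)
    fix c assume "c \<in> Fp"
    show "Re (chi c) \<le> 1" using complex_Re_le_cmod[of "chi c"] by simp
    show "0 \<le> B - real (N c)" using NB[OF \<open>c \<in> Fp\<close>] by simp
  qed
  also have "\<dots> = real p * B - (real p ^ n - 1)"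
    using sumN card_Fp by (simp add: sum_subtractf)
  also have "\<dots> = 3 * real p * real p ^ \<mu> + 1"
    unfolding pB by simp
  finally show ?thesis by (simp add: n_def)
qed

text \<open>
The one-sided bounds for the fields with \<open>p^(2^k)\<close> elements, \<open>k \<ge> 1\<close>, bound the sum over the prime
field on both sides, since \<open>r \<mapsto> r\<^sup>2 - 2\<close> maps \<open>r < -2\<close> and \<open>r > 2\<close> into \<open>r > 2\<close>
and from there increases without bound.
\<close>
theorem Weil_bound:
  assumes a: "a \<in> Fp" "a \<noteq> 0"
  shows "norm (Kl 1 a) \<le> 2 * sqrt (real p)"
proof (rule ccontr)
  assume neg: "\<not> norm (Kl 1 a) \<le> 2 * sqrt (real p)"
  define w where "w = sqrt (real p)"
  have w: "w > 0" "w\<^sup>2 = real p" using p_gt_1 by (auto simp: w_def)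
  define R where "R = (\<lambda>n. Re (Kl n a))"
  have Kre: "Kl n a = of_real (R n)" for n
    using Kl_real[OF Fp_subset_GF[THEN subsetD, OF a(1)], of n] by (simp add: R_def of_real_Re)
  define r where "r = (\<lambda>k. - R (2 ^ k) / w ^ (2 ^ k))"
  have aG: "a \<in> GF n" for n using a Fp_subset_GF by auto
  have rec: "r (Suc k) = (r k)\<^sup>2 - 2" for k
  proof -
    have "Kl (2 * 2 ^ k) a = 2 * of_nat (p ^ 2 ^ k) - (Kl (2 ^ k) a)\<^sup>2"
      by (rule Kl_double[OF _ aG a(2)]) simp
    hence "(of_real (R (2 * 2 ^ k)) :: complex) = of_real (2 * real p ^ (2 ^ k) - (R (2 ^ k))\<^sup>2)"
      unfolding Kre by simp
    hence "R (2 * 2 ^ k) = 2 * real p ^ (2 ^ k) - (R (2 ^ k))\<^sup>2"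
      by (simp only: of_real_eq_iff)
    moreover have "w ^ (2 * 2 ^ k) = real p ^ (2 ^ k)" using w(2) by (simp add: power_mult)
    moreover have "(w ^ 2 ^ k)\<^sup>2 = real p ^ (2 ^ k)" 
      using w(2) by (metis power_mult mult.commute)
    ultimately show ?thesis using p_gt_1
      by (simp add: r_def power_divide field_simps)
  qed
  have bound: "r (Suc k) \<le> 3 * real p + 1" for k
  proof -
    have "- R (2 * 2 ^ k) \<le> 3 * real p * real p ^ (2 ^ k) + 1"
      unfolding R_def by (rule Kl_lower_bound[OF a]) simp
    also have "1 \<le> real p ^ (2 ^ k)" using p_gt_1 by simp
    finally have "- R (2 * 2 ^ k) \<le> (3 * real p + 1) * real p ^ (2 ^ k)"
      by (simp add: algebra_simps)
    moreover have "w ^ (2 * 2 ^ k) = real p ^ (2 ^ k)" using w(2) by (simp add: power_mult)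
    ultimately show ?thesis using p_gt_1 by (simp add: r_def field_simps)
  qed
  have "norm (Kl 1 a) > 2 * w" using neg by (simp add: w_def)
  moreover have "norm (Kl 1 a) = \<bar>R 1\<bar>" unfolding Kre by (rule norm_of_real)
  ultimately have "\<bar>r 0\<bar> > 2" using w by (simp add: r_def abs_divide field_simps)
  hence "(r 0)\<^sup>2 > 2\<^sup>2" using power2_strict_mono[of 2 "r 0"] by simp
  hence r1: "r 1 > 2" using rec[of 0] by simp
  define d where "d = r 1 - 2"
  \<comment> \<open>From \<open>r\<^sup>2 - 4 = (r - 2)(r + 2)\<close>, the distance to the fixed point \<open>2\<close> grows at least fourfold.\<close>
  have grow: "r (Suc k) \<ge> 2 + d * 4 ^ k" for k
  proof (induction k)
    case (Suc k)
    have ge: "r (Suc k) - 2 \<ge> d * 4 ^ k" "d * 4 ^ k \<ge> 0" using Suc r1 by (auto simp: d_def)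
    have "d * 4 ^ k * 4 \<le> (r (Suc k) - 2) * (r (Suc k) + 2)"
      by (rule mult_mono) (use ge in auto)
    also have "\<dots> = r (Suc (Suc k)) - 2" by (simp add: rec[of "Suc k"] algebra_simps power2_eq_square)
    finally show ?case by simp
  qed (simp add: d_def)
  obtain k where "(3 * real p + 1) / d < 4 ^ k" using real_arch_pow[of 4] by auto
  hence "3 * real p + 1 < d * 4 ^ k" using r1 pos_divide_less_eq[of d] by (simp add: d_def mult.commute)
  thus False using bound[of k] grow[of k] by linarith
qed

end

section \<open>Kloosterman sums modulo a prime\<close>

definition e_mod :: "nat \<Rightarrow> int \<Rightarrow> complex" where
  "e_mod p m = cis (2 * pi * of_int m / of_nat p)"

definition kloosterman_sum :: "nat \<Rightarrow> int \<Rightarrow> int \<Rightarrow> complex" where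
  "kloosterman_sum p h k = (\<Sum>a\<in>{1..int p - 1}. e_mod p (h * a + k * modular_inverse (int p) a))"

lemma e_mod_0 [simp]: "e_mod p 0 = 1"
  by (simp add: e_mod_def)

lemma e_mod_add: "e_mod p (m + n) = e_mod p m * e_mod p n"
  by (simp add: e_mod_def cis_mult add_divide_distrib distrib_left)

lemma e_mod_power: "e_mod p m ^ n = e_mod p (int n * m)"
  by (induction n) (simp_all add: distrib_right e_mod_add)

lemma e_mod_multiple: "p > 0 \<Longrightarrow> e_mod p (int p * m) = 1"
proof -
  assume "p > 0"
  hence "2 * pi * real_of_int (int p * m) / real p = 2 * pi * of_int m" by simp
  thus ?thesis unfolding e_mod_def by (simp only: cis_multiple_2pi Ints_of_int)
qed

lemma e_mod_cong:
  assumes "p > 0" "[m = n] (mod int p)"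
  shows "e_mod p m = e_mod p n"
proof -
  obtain k where "m = n + int p * k" using assms(2) by (metis cong_iff_lin cong_sym mult.commute)
  thus ?thesis using e_mod_multiple[OF assms(1)] by (simp add: e_mod_add)
qed

lemma coprime_int_prime:
  assumes "prime p" "a \<in> {1..int p - 1}"
  shows "coprime a (int p)"
proof -
  have "\<not> int p dvd a" using assms(2) by (auto dest: zdvd_imp_le)
  moreover have "prime (int p)" using assms(1) by simp
  ultimately show ?thesis by (metis coprime_commute prime_imp_coprime)
qed

context char_p_alg_closed
begin

lemma chi_of_int: "chi (of_int m) = e_mod p m"
proof -
  have pp: "int p > 0" using p_gt_1 by simp
  define n where "n = nat (m mod int p)"
  have n: "int n = m mod int p" using pp by (simp add: n_def)
  have c: "[m = int n] (mod int p)" using n by (simp add: cong_def)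
  hence "(of_int m :: 'a) = of_int (int n)"
    by (simp only: of_int_eq_iff_cong_CHAR char_p)
  hence "chi (of_int m) = chi (of_nat n)" by simp
  also have "\<dots> = e_mod p (int n)" by (simp add: chi_of_nat e_mod_def)
  also have "\<dots> = e_mod p m" using e_mod_cong[OF _ c] p_gt_1 by simp
  finally show ?thesis .
qed

lemma of_int_eq_0_iff_dvd: "(of_int m :: 'a) = 0 \<longleftrightarrow> int p dvd m"
  by (simp add: of_int_eq_0_iff_char_dvd char_p)

text \<open>
Over the prime field, \<open>x \<mapsto> x/h\<close> turns \<open>h x + k/x\<close> into \<open>x + h k/x\<close>.
\<close>
lemma kloosterman_sum_eq_Kl:
  assumes h: "\<not> int p dvd h"
  shows "kloosterman_sum p h k = Kl 1 (of_int h * of_int k)"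
proof -
  define H K where "H = (of_int h :: 'a)" and "K = (of_int k :: 'a)"
  have H0: "H \<noteq> 0" using h by (simp add: H_def of_int_eq_0_iff_dvd)
  have SI: "of_int m \<in> Fp" for m
    by (cases m rule: int_cases2) (auto intro: Fp_of_nat Fp_uminus)
  have HS: "H \<in> Fp" unfolding H_def by (rule SI)
  have Fp_divide: "x / y \<in> Fp" if "x \<in> Fp" "y \<in> Fp" for x y
    unfolding divide_inverse by (intro Fp_mult Fp_inverse that)
  have bij: "bij_betw (of_int :: int \<Rightarrow> 'a) {1..int p - 1} (Fp - {0})"
    unfolding bij_betw_def
  proof
    show inj: "inj_on (of_int :: int \<Rightarrow> 'a) {1..int p - 1}"
    proof (rule inj_onI)
      fix x y assume xy: "x \<in> {1..int p - 1}" "y \<in> {1..int p - 1}" "(of_int x :: 'a) = of_int y"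
      hence "[x = y] (mod int p)" by (simp add: of_int_eq_iff_cong_CHAR char_p)
      thus "x = y" using xy(1,2) by (simp add: cong_def)
    qed
    have "card ((of_int :: int \<Rightarrow> 'a) ` {1..int p - 1}) = p - 1"
      using inj by (simp add: card_image nat_diff_distrib)
    moreover have "card (Fp - {0}) = p - 1" using card_Fp finite_Fp by simp
    moreover have "(of_int :: int \<Rightarrow> 'a) ` {1..int p - 1} \<subseteq> Fp - {0}"
      using SI zdvd_not_zless[of _ "int p"] by (auto simp: of_int_eq_0_iff_dvd)
    ultimately show "(of_int :: int \<Rightarrow> 'a) ` {1..int p - 1} = Fp - {0}"
      using finite_Fp by (intro card_subset_eq) auto
  qed
  have "kloosterman_sum p h k = (\<Sum>a\<in>{1..int p - 1}. chi (H * of_int a + K / of_int a))"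
    unfolding kloosterman_sum_def
  proof (rule sum.cong)
    fix a assume a: "a \<in> {1..int p - 1}"
    have "coprime a (int p)" by (rule coprime_int_prime[OF prime_p a])
    hence "[a * modular_inverse (int p) a = 1] (mod int p)" by (rule cong_modular_inverse1)
    hence "of_int (a * modular_inverse (int p) a) = (of_int 1 :: 'a)"
      by (simp only: of_int_eq_iff_cong_CHAR char_p)
    hence 1: "of_int a * of_int (modular_inverse (int p) a) = (1 :: 'a)" by simp
    have "(of_int a :: 'a) \<noteq> 0" using 1 by auto
    hence "of_int (modular_inverse (int p) a) = 1 / (of_int a :: 'a)"
      using 1 by (simp add: field_simps)
    thus "e_mod p (h * a + k * modular_inverse (int p) a) = chi (H * of_int a + K / of_int a)"
      unfolding chi_of_int [symmetric] by (simp add: H_def K_def)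
  qed simp
  also have "\<dots> = (\<Sum>x\<in>Fp - {0}. chi (H * x + K / x))"
    by (rule sum.reindex_bij_betw[OF bij])
  also have "\<dots> = (\<Sum>x\<in>Fp - {0}. chi (x + (H * K) / x))"
    by (rule sum.reindex_bij_witness[of _ "\<lambda>x. x / H" "\<lambda>x. H * x"])
       (use H0 HS in \<open>auto intro: Fp_mult Fp_divide\<close>)
  also have "\<dots> = Kl 1 (H * K)"
    unfolding Kl_def GF_one_eq psi_def Tr_1 ..
  finally show ?thesis by (simp add: H_def K_def)
qed

lemma kloosterman_sum_bound_field:
  assumes h: "\<not> int p dvd h" and k: "\<not> int p dvd k"
  shows "kloosterman_sum p h k \<in> \<real> \<and> norm (kloosterman_sum p h k) \<le> 2 * sqrt (real p)"
proof -
  have SI: "of_int m \<in> Fp" for m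
    by (cases m rule: int_cases2) (auto intro: Fp_of_nat Fp_uminus)
  have 1: "(of_int h * of_int k :: 'a) \<in> Fp" by (intro Fp_mult SI)
  have 2: "(of_int h * of_int k :: 'a) \<noteq> 0" using h k by (simp add: of_int_eq_0_iff_dvd)
  show ?thesis
    unfolding kloosterman_sum_eq_Kl[OF h]
    using Weil_bound[OF 1 2] Kl_real[of _ 1] 1 by (simp add: GF_one_eq flip: One_nat_def)
qed

end

text \<open>
In the results so far \<open>p\<close> is the characteristic of a type, whereas the bound is wanted for every
prime number. The proof is therefore by contradiction on one fixed prime: if the bound fails for some
prime, let \<open>test_prime\<close> be such a prime, and otherwise any odd prime. This is a closed term, so there is a
type with that many elements, and the algebraic closure of the corresponding prime field shows that
the bound holds for \<open>test_prime\<close> after all.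
\<close>
definition exceptional :: "nat \<Rightarrow> bool" where
  "exceptional p \<longleftrightarrow> prime p \<and> odd p \<and> (\<exists>h k. \<not> int p dvd h \<and> \<not> int p dvd k \<and>
     \<not> (kloosterman_sum p h k \<in> \<real> \<and> norm (kloosterman_sum p h k) \<le> 2 * sqrt (real p)))"

definition test_prime :: nat where
  "test_prime = (if \<exists>p. exceptional p then SOME p. exceptional p else 3)"

lemma test_prime_prime: "prime test_prime" and odd_test_prime: "odd test_prime"
proof -
  have "prime test_prime \<and> odd test_prime"
  proof (cases "\<exists>p. exceptional p")
    case True
    hence "exceptional test_prime" unfolding test_prime_def using someI_ex[OF True] by (simp only: if_True)
    thus ?thesis unfolding exceptional_def by blast
  next
    case False
    hence eq: "test_prime = 3" unfolding test_prime_def by (simp only: if_False)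
    show ?thesis unfolding eq by simp
  qed
  thus "prime test_prime" "odd test_prime" by blast+
qed

typedef test_residues = "{..<test_prime}"
  using test_prime_prime prime_gt_0_nat by blast

lemma CARD_test_residues: "CARD(test_residues) = test_prime"
  using type_definition.card[OF type_definition_test_residues] by simp

instance test_residues :: prime_card
  by standard (simp add: CARD_test_residues test_prime_prime)

theorem Weil_bound_kloosterman_sum:
  assumes p: "prime p" "odd p" and h: "\<not> int p dvd h" and k: "\<not> int p dvd k"
  shows "kloosterman_sum p h k \<in> \<real>" "norm (kloosterman_sum p h k) \<le> 2 * sqrt (real p)"
proof -
  interpret char_p_alg_closed "TYPE(test_residues mod_ring alg_closure)" test_prime
    by unfold_locales (simp_all add: test_prime_prime odd_test_prime CARD_test_residues)
  have no: "\<not> exceptional test_prime"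
    unfolding exceptional_def using kloosterman_sum_bound_field by blast
  have "kloosterman_sum p h k \<in> \<real> \<and> norm (kloosterman_sum p h k) \<le> 2 * sqrt (real p)"
  proof (rule ccontr)
    assume "\<not> ?thesis"
    hence "exceptional p"
      unfolding exceptional_def by (intro conjI p exI[of _ h] exI[of _ k] h k)
    hence ex: "\<exists>p. exceptional p" by blast
    from someI_ex[OF ex] have "exceptional test_prime" unfolding test_prime_def using ex by (simp only: if_True)
    with no show False by blast
  qed
  thus "kloosterman_sum p h k \<in> \<real>" "norm (kloosterman_sum p h k) \<le> 2 * sqrt (real p)"
    by simp_all
qed

section \<open>Completion of the parity sum\<close>

definition sgn_parity :: "int \<Rightarrow> complex" where
  "sgn_parity b = (if even b then 1 else -1)"

definition parity_coeff :: "nat \<Rightarrow> int \<Rightarrow> complex" where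
  "parity_coeff p h = (\<Sum>b\<in>{1..int p - 1}. sgn_parity b * e_mod p (- (h * b)))"

lemma e_mod_eq_1_iff:
  assumes "p > 0" shows "e_mod p m = 1 \<longleftrightarrow> int p dvd m"
proof
  assume "e_mod p m = 1"
  hence "cos (2 * pi * of_int m / real p) = 1" by (simp add: e_mod_def complex_eq_iff)
  then obtain k :: int where "2 * pi * of_int m / real p = of_int k * 2 * pi"
    using cos_one_2pi_int by auto
  hence "real_of_int m = of_int k * real p" using assms by (simp add: field_simps)
  hence "m = k * int p" by (metis of_int_eq_iff of_int_mult of_int_of_nat_eq)
  thus "int p dvd m" by simp
next
  assume "int p dvd m"
  then obtain k where "m = int p * k" by (elim dvdE)
  thus "e_mod p m = 1" using e_mod_multiple[OF assms] by simp
qed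

lemma sum_e_mod_nat:
  assumes "p > 0"
  shows "(\<Sum>h<p. e_mod p (int h * d)) = (if int p dvd d then of_nat p else 0)"
proof (cases "int p dvd d")
  case True
  hence "e_mod p (int h * d) = 1" for h using e_mod_eq_1_iff[OF assms] by simp
  thus ?thesis using True by simp
next
  case False
  hence w: "e_mod p d \<noteq> 1" using e_mod_eq_1_iff[OF assms] by simp
  have "(\<Sum>h<p. e_mod p (int h * d)) = (\<Sum>h<p. e_mod p d ^ h)" by (simp add: e_mod_power)
  also have "\<dots> = (e_mod p d ^ p - 1) / (e_mod p d - 1)" using w by (rule geometric_sum)
  also have "e_mod p d ^ p = 1" using e_mod_multiple[OF assms] by (simp add: e_mod_power)
  finally show ?thesis using False by simp
qed

lemma sum_int_eq_nat: "(\<Sum>b\<in>{1..int p - 1}. f b) = (\<Sum>b\<in>{1..<p}. f (int b))"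
  by (rule sum.reindex_bij_witness[of _ int nat]) auto

lemma sgn_parity_nat: "sgn_parity (int b) = (- 1) ^ b"
  by (simp add: sgn_parity_def)

text \<open>
Fourier inversion modulo \<open>p\<close>, for the function that is \<open>(-1)\<^sup>a\<close> on \<open>{1..p - 1}\<close> and \<open>0\<close> at \<open>0\<close>.
\<close>
lemma parity_inversion:
  assumes "p > 0" and a: "a \<in> {1..int p - 1}"
  shows "sgn_parity a = (1 / of_nat p) * (\<Sum>h<p. parity_coeff p (int h) * e_mod p (int h * a))"
proof -
  have "(\<Sum>h<p. parity_coeff p (int h) * e_mod p (int h * a))
      = (\<Sum>h<p. \<Sum>b\<in>{1..int p - 1}. sgn_parity b * e_mod p (int h * (a - b)))"
    by (simp add: parity_coeff_def sum_distrib_right mult.assoc right_diff_distrib flip: e_mod_add)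
  also have "\<dots> = (\<Sum>b\<in>{1..int p - 1}. \<Sum>h<p. sgn_parity b * e_mod p (int h * (a - b)))"
    by (rule sum.swap)
  also have "\<dots> = (\<Sum>b\<in>{1..int p - 1}. if b = a then sgn_parity b * of_nat p else 0)"
  proof (rule sum.cong)
    fix b assume b: "b \<in> {1..int p - 1}"
    have "int p dvd (a - b) \<longleftrightarrow> b = a"
    proof
      assume d: "int p dvd (a - b)"
      have "\<bar>a - b\<bar> < int p" using a b by auto
      hence "a - b = 0" using d zdvd_not_zless[of "\<bar>a - b\<bar>" "int p"] by auto
      thus "b = a" by simp
    qed simp
    thus "(\<Sum>h<p. sgn_parity b * e_mod p (int h * (a - b))) = (if b = a then sgn_parity b * of_nat p else 0)"
      using sum_e_mod_nat[OF assms(1), of "a - b"] by (simp flip: sum_distrib_left)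
  qed simp
  also have "\<dots> = sgn_parity a * of_nat p" using a by simp
  finally show ?thesis using assms(1) by simp
qed

text \<open>
With \<open>z = exp (-2 \<pi> i h / p)\<close> the geometric sum of \<open>(-z)^b\<close> over \<open>1 \<le> b < p\<close> is \<open>(1 - z)/(1 + z)\<close>,
because \<open>p\<close> is odd and \<open>z^p = 1\<close>. Leaving out \<open>b = 0\<close> is what produces a tangent here, and in
particular the value \<open>0\<close> at \<open>h = 0\<close>.
\<close>
lemma norm_parity_coeff:
  assumes "odd p"
  shows "norm (parity_coeff p (int h)) = \<bar>tan (pi * real h / real p)\<bar>"
proof -
  have p: "p > 0" using assms by (cases p) auto
  define z where "z = e_mod p (- int h)"
  define \<theta> where "\<theta> = pi * real h / real p"
  have zp: "z ^ p = 1" using e_mod_multiple[OF p, of "- int h"] by (simp add: z_def e_mod_power)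
  have z1: "1 + z \<noteq> 0"
  proof
    assume "1 + z = 0"
    hence "z = - 1" by (simp add: eq_neg_iff_add_eq_0 add.commute)
    thus False using zp assms by simp
  qed
  have z2: "- z \<noteq> 1"
  proof
    assume "- z = 1"
    hence "1 + z = - z + z" by (simp only:)
    thus False using z1 by simp
  qed
  have "parity_coeff p (int h) = (\<Sum>b\<in>{1..<p}. (- z) ^ b)"
    unfolding parity_coeff_def sum_int_eq_nat
    by (rule sum.cong) (simp_all add: sgn_parity_nat z_def power_minus[of "e_mod p _"] e_mod_power mult.commute)
  also have "\<dots> = (\<Sum>b<p. (- z) ^ b) - 1"
    using p by (simp add: lessThan_atLeast0 sum.atLeast_Suc_lessThan)
  also have "\<dots> = ((- z) ^ p - 1) / (- z - 1) - 1"
    using z2 by (simp add: geometric_sum)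
  also have "(- z) ^ p = - 1" using zp assms by simp
  also have "(- 1 - 1) / (- z - 1) - 1 = (1 - z) / (1 + z)"
  proof -
    have e: "- z - 1 = - (1 + z)" "(- 1 - 1 :: complex) = - 2" by simp_all
    have "- 2 / - (1 + z) = 2 / (1 + z)" by (rule minus_divide_divide)
    thus ?thesis unfolding e using z1 by (simp add: field_simps)
  qed
  finally have c: "norm (parity_coeff p (int h)) = norm (1 - z) / norm (1 + z)" by (simp add: norm_divide)
  have z: "z = cis (- (2 * \<theta>))" by (simp add: z_def e_mod_def \<theta>_def algebra_simps)
  have cs: "cos \<theta> ^ 2 + sin \<theta> ^ 2 = 1" by simp
  have m: "(norm (1 - z))\<^sup>2 = (2 * sin \<theta>)\<^sup>2"
  proof -
    have "(norm (1 - z))\<^sup>2 = (1 - cos (2 * \<theta>))\<^sup>2 + (sin (2 * \<theta>))\<^sup>2" by (simp add: z cmod_power2)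
    also have "\<dots> = 2 - 2 * cos (2 * \<theta>)"
      using sin_cos_squared_add[of "2 * \<theta>"] by (simp add: power2_eq_square algebra_simps)
    also have "\<dots> = (2 * sin \<theta>)\<^sup>2" by (simp add: cos_double_sin power_mult_distrib)
    finally show ?thesis .
  qed
  have q: "(norm (1 + z))\<^sup>2 = (2 * cos \<theta>)\<^sup>2"
  proof -
    have "(norm (1 + z))\<^sup>2 = (1 + cos (2 * \<theta>))\<^sup>2 + (sin (2 * \<theta>))\<^sup>2" by (simp add: z cmod_power2)
    also have "\<dots> = 2 + 2 * cos (2 * \<theta>)"
      using sin_cos_squared_add[of "2 * \<theta>"] by (simp add: power2_eq_square algebra_simps)
    also have "\<dots> = (2 * cos \<theta>)\<^sup>2" by (simp add: cos_double_cos power_mult_distrib)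
    finally show ?thesis .
  qed
  have "norm (1 - z) = \<bar>2 * sin \<theta>\<bar>" using m by (metis norm_ge_zero abs_of_nonneg power2_eq_iff_nonneg power2_abs abs_ge_zero)
  moreover have "norm (1 + z) = \<bar>2 * cos \<theta>\<bar>" using q by (metis norm_ge_zero abs_of_nonneg power2_eq_iff_nonneg power2_abs abs_ge_zero)
  ultimately show ?thesis using c by (simp add: tan_def abs_mult abs_divide \<theta>_def)
qed

definition parity_correlation :: "nat \<Rightarrow> complex" where
  "parity_correlation p = (\<Sum>a\<in>{1..int p - 1}. sgn_parity a * sgn_parity (modular_inverse (int p) a))"

lemma modular_inverse_range:
  assumes "prime p" "a \<in> {1..int p - 1}"
  shows "modular_inverse (int p) a \<in> {1..int p - 1}"
proof -
  have p1: "int p > 1" using prime_gt_1_nat[OF assms(1)] by simp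
  show ?thesis
    using mult_modular_inverse_int_pos[OF p1 coprime_int_prime[OF assms]]
      modular_inverse_int_less[of "int p" a] p1 by simp
qed

text \<open>
The product of the two signs is \<open>-1\<close> exactly for the Lehmer numbers.
\<close>
lemma parity_correlation_eq_lehmer:
  assumes "prime p" 
  shows "parity_correlation p = of_real (real p - 1 - 2 * real (lehmer_count p))"
proof -
  define I where "I = {1..int p - 1}"
  define B where "B = {a \<in> I. odd (a + modular_inverse (int p) a)}"
  have fin: "finite I" by (simp add: I_def)
  hence "finite B" by (simp add: B_def)
  have "{a. lehmer_number p a} = B" by (auto simp: lehmer_number_def B_def I_def)
  hence M: "lehmer_count p = card B" by (simp add: lehmer_count_def)
  have "parity_correlation p = (\<Sum>a\<in>I. 1 - 2 * (if a \<in> B then 1 else 0))"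
    unfolding parity_correlation_def I_def [symmetric]
    by (rule sum.cong) (auto simp: B_def sgn_parity_def)
  also have "\<dots> = of_nat (card I) - 2 * (\<Sum>a\<in>I. if a \<in> B then 1 else 0)"
    by (simp add: sum_subtractf flip: sum_distrib_left)
  also have "(\<Sum>a\<in>I. if a \<in> B then 1 else (0 :: complex)) = of_nat (card B)"
    using fin by (simp add: sum.If_cases B_def Int_def conj_commute)
  also have "card I = p - 1" by (simp add: I_def nat_diff_distrib)
  finally show ?thesis using M prime_gt_1_nat[OF assms] by (simp add: of_nat_diff)
qed

lemma parity_correlation_eq_kloosterman:
  assumes "p > 0" "prime p"
  shows "parity_correlation p = (1 / of_nat p)\<^sup>2 *
    (\<Sum>h<p. \<Sum>k<p. parity_coeff p (int h) * parity_coeff p (int k) * kloosterman_sum p (int h) (int k))"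
proof -
  let ?c = "\<lambda>h. parity_coeff p (int h)"
  let ?v = "modular_inverse (int p)"
  have "parity_correlation p = (\<Sum>a\<in>{1..int p - 1}.
      (1 / of_nat p * (\<Sum>h<p. ?c h * e_mod p (int h * a))) *
      (1 / of_nat p * (\<Sum>k<p. ?c k * e_mod p (int k * ?v a))))"
    unfolding parity_correlation_def
  proof (rule sum.cong)
    fix a assume a: "a \<in> {1..int p - 1}"
    show "sgn_parity a * sgn_parity (?v a) =
      (1 / of_nat p * (\<Sum>h<p. ?c h * e_mod p (int h * a))) *
      (1 / of_nat p * (\<Sum>k<p. ?c k * e_mod p (int k * ?v a)))"
      unfolding parity_inversion[OF assms(1) a, symmetric]
        parity_inversion[OF assms(1) modular_inverse_range[OF assms(2) a], symmetric] ..
  qed simp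
  also have "\<dots> = (1 / of_nat p)\<^sup>2 * (\<Sum>a\<in>{1..int p - 1}.
      (\<Sum>h<p. ?c h * e_mod p (int h * a)) * (\<Sum>k<p. ?c k * e_mod p (int k * ?v a)))"
  proof -
    have "(1 / of_nat p * x) * (1 / of_nat p * y) = (1 / of_nat p)\<^sup>2 * (x * y)" for x y :: complex
      by (simp add: power2_eq_square)
    thus ?thesis by (simp only: sum_distrib_left [of "(1 / of_nat p)\<^sup>2"])
  qed
  also have "(\<Sum>a\<in>{1..int p - 1}.
      (\<Sum>h<p. ?c h * e_mod p (int h * a)) * (\<Sum>k<p. ?c k * e_mod p (int k * ?v a)))
    = (\<Sum>a\<in>{1..int p - 1}. \<Sum>h<p. \<Sum>k<p. ?c h * ?c k * e_mod p (int h * a + int k * ?v a))"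
    unfolding sum_product e_mod_add by (intro sum.cong refl) (simp add: mult_ac)
  also have "\<dots> = (\<Sum>h<p. \<Sum>k<p. \<Sum>a\<in>{1..int p - 1}. ?c h * ?c k * e_mod p (int h * a + int k * ?v a))"
    by (subst sum.swap, intro sum.cong refl, rule sum.swap)
  also have "\<dots> = (\<Sum>h<p. \<Sum>k<p. ?c h * ?c k * kloosterman_sum p (int h) (int k))"
    unfolding kloosterman_sum_def sum_distrib_left ..
  finally show ?thesis .
qed

text \<open>
The tangent is odd about \<open>\<pi>/2\<close>, so \<open>h\<close> and \<open>p - h\<close> contribute equally.
\<close>
lemma sum_abs_tan:
  assumes "odd p"
  shows "(\<Sum>h\<in>{1..<p}. \<bar>tan (pi * real h / real p)\<bar>)
    = 2 * (\<Sum>j = 1..(p - 1) div 2. tan (pi * real j / real p))"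
proof -
  let ?t = "\<lambda>h. \<bar>tan (pi * real h / real p)\<bar>"
  define m where "m = (p - 1) div 2"
  have p: "p = 2 * m + 1" using assms by (simp add: m_def)
  have "(\<Sum>h\<in>{1..<p}. ?t h) = (\<Sum>h\<in>{1..m}. ?t h) + (\<Sum>h\<in>{m+1..<p}. ?t h)"
  proof -
    have "{1..<p} = {1..m} \<union> {m+1..<p}" using p by auto
    thus ?thesis by (simp only:) (rule sum.union_disjoint, auto)
  qed
  also have "(\<Sum>h\<in>{m+1..<p}. ?t h) = (\<Sum>h\<in>{1..m}. ?t h)"
  proof (rule sum.reindex_bij_witness[of _ "\<lambda>h. p - h" "\<lambda>h. p - h"])
    fix h assume h: "h \<in> {m+1..<p}"
    have "pi * real (p - h) / real p = pi - pi * real h / real p"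
      using h by (simp add: of_nat_diff field_simps)
    thus "?t (p - h) = ?t h" by (simp add: tan_def)
  qed (use p in auto)
  also have "(\<Sum>h\<in>{1..m}. ?t h) = (\<Sum>h\<in>{1..m}. tan (pi * real h / real p))"
  proof (rule sum.cong)
    fix j assume "j \<in> {1..m}"
    hence "2 * j < p" using p by auto
    hence "pi * (2 * real j) < pi * real p" by (intro mult_strict_left_mono) auto
    hence "tan (pi * real j / real p) \<ge> 0" using p by (intro tan_pos_pi2_le) (auto simp: field_simps)
    thus "?t j = tan (pi * real j / real p)" by simp
  qed simp
  finally show ?thesis by (simp add: m_def)
qed

text \<open>
For fixed \<open>a\<close> the sum over \<open>k\<close> is a full sum over characters without the term \<open>k = 0\<close>, that is \<open>-1\<close>;
the remaining sum of characters over \<open>a\<close> is \<open>-1\<close> again.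
\<close>
lemma sum_kloosterman_sum:
  assumes "prime p"
  shows "(\<Sum>k\<in>{1..<p}. kloosterman_sum p 1 (int k)) = 1"
proof -
  have p: "p > 0" "p > 1" using prime_gt_1_nat[OF assms] by auto
  have full: "(\<Sum>k\<in>{1..<p}. e_mod p (int k * d)) = - 1" if "\<not> int p dvd d" for d
  proof -
    have "(\<Sum>k<p. e_mod p (int k * d)) = 0" using that sum_e_mod_nat[OF p(1)] by simp
    thus ?thesis using p by (simp add: lessThan_atLeast0 sum.atLeast_Suc_lessThan add_eq_0_iff)
  qed
  have nd: "\<not> int p dvd a" if "a \<in> {1..int p - 1}" for a
    using that zdvd_not_zless[of a "int p"] by auto
  have "(\<Sum>k\<in>{1..<p}. kloosterman_sum p 1 (int k))
      = (\<Sum>a\<in>{1..int p - 1}. \<Sum>k\<in>{1..<p}. e_mod p a * e_mod p (int k * modular_inverse (int p) a))"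
    unfolding kloosterman_sum_def by (subst sum.swap) (simp add: e_mod_add)
  also have "\<dots> = (\<Sum>a\<in>{1..int p - 1}. - e_mod p a)"
  proof (rule sum.cong)
    fix a assume a: "a \<in> {1..int p - 1}"
    show "(\<Sum>k\<in>{1..<p}. e_mod p a * e_mod p (int k * modular_inverse (int p) a)) = - e_mod p a"
      using full[OF nd[OF modular_inverse_range[OF assms a]]] by (simp flip: sum_distrib_left)
  qed simp
  also have "\<dots> = - (\<Sum>k\<in>{1..<p}. e_mod p (int k * 1))"
    by (simp add: sum_negf sum_int_eq_nat)
  also have "\<dots> = 1" using full[of 1] nd[of 1] p by simp
  finally show ?thesis .
qed

text \<open>
Otherwise every \<open>K(1,k)\<close> is \<open>\<plusminus> 2 \<surd>p\<close>, and their sum \<open>1\<close> is an integer multiple \<open>n\<close> of \<open>2 \<surd>p\<close>.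
Squaring gives \<open>4 p n\<^sup>2 = 1\<close>.
\<close>
lemma exists_small_kloosterman_sum:
  assumes p: "prime p" "odd p"
  shows "\<exists>k\<in>{1..<p}. norm (kloosterman_sum p 1 (int k)) < 2 * sqrt (real p)"
proof (rule ccontr)
  assume neg: "\<not> ?thesis"
  have p1: "p > 1" using prime_gt_1_nat[OF p(1)] .
  define w where "w = 2 * sqrt (real p)"
  have w: "w > 0" "w\<^sup>2 = 4 * real p" using p1 by (auto simp: w_def power_mult_distrib)
  have nd: "\<not> int p dvd int k" if "k \<in> {1..<p}" for k
    using that zdvd_not_zless[of "int k" "int p"] by auto
  have "\<exists>s::int. kloosterman_sum p 1 (int k) = of_real (w * of_int s)" if k: "k \<in> {1..<p}" for k
  proof -
    have 1: "\<not> int p dvd 1" using nd[of 1] p1 by simp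
    note W = Weil_bound_kloosterman_sum[OF p 1 nd[OF k]]
    obtain r where r: "kloosterman_sum p 1 (int k) = of_real r" using W(1) by (auto elim: Reals_cases)
    have "\<bar>r\<bar> = w" using W(2) neg k r by (force simp: w_def)
    hence "r = w * of_int 1 \<or> r = w * of_int (- 1)" using w by auto
    thus ?thesis using r by metis
  qed
  then obtain s :: "nat \<Rightarrow> int" where s: "\<And>k. k \<in> {1..<p} \<Longrightarrow> kloosterman_sum p 1 (int k) = of_real (w * of_int (s k))"
    by metis
  define n where "n = (\<Sum>k\<in>{1..<p}. s k)"
  have "(\<Sum>k\<in>{1..<p}. kloosterman_sum p 1 (int k)) = of_real (w * of_int n)"
    using s by (simp add: n_def sum_distrib_left)
  hence "(of_real (w * of_int n) :: complex) = of_real 1" using sum_kloosterman_sum[OF p(1)] by simp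
  hence "w * of_int n = 1" by (simp only: of_real_eq_iff)
  hence "w\<^sup>2 * (of_int n)\<^sup>2 = 1" by (simp flip: power_mult_distrib)
  hence "real_of_int (4 * int p * n\<^sup>2) = real_of_int 1" using w by simp
  hence "4 * int p * n\<^sup>2 = 1" by (simp only: of_int_eq_iff)
  hence "(4 :: int) dvd 1" by (metis dvd_triv_left mult.assoc)
  thus False by simp
qed

text \<open>
Bound each Kloosterman sum in \<open>parity_correlation_eq_kloosterman\<close> by \<open>2 \<surd>p\<close>. Terms with \<open>h = 0\<close> or
\<open>k = 0\<close>, where that bound is not available, have coefficient \<open>0\<close>. Strictness comes from
\<open>exists_small_kloosterman_sum\<close>, as all other weights are positive.
\<close>
theorem lehmer_count_bound:
  assumes p: "prime p" "p > 3"
  defines "A \<equiv> (\<Sum>j = 1..(p - 1) div 2. tan (pi * real j / real p))"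
  shows "\<bar>real (lehmer_count p) - (real p - 1) / 2\<bar> < (2 * A / real p)\<^sup>2 * sqrt (real p)"
proof -
  have odd: "odd p" using p prime_odd_nat by auto
  have p0: "p > 0" using p by simp
  define t where "t = (\<lambda>h. \<bar>tan (pi * real h / real p)\<bar>)"
  define K where "K = (\<lambda>h k. norm (kloosterman_sum p (int h) (int k)))"
  define w where "w = 2 * sqrt (real p)"
  define P where "P = {1..<p} \<times> {1..<p}"
  have t0: "t 0 = 0" by (simp add: t_def)
  have tpos: "t h > 0" if h: "h \<in> {1..<p}" for h
  proof -
    define \<theta> where "\<theta> = pi * real h / real p"
    have "sin \<theta> > 0" unfolding \<theta>_def using h by (intro sin_gt_zero) (auto simp: field_simps)
    moreover have "cos \<theta> \<noteq> 0"
    proof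
      assume c: "cos \<theta> = 0"
      have "sin (2 * \<theta>) = 0" "cos (2 * \<theta>) = - 1" using c by (simp_all add: sin_double cos_double_cos)
      moreover have "e_mod p (int h) = cis (2 * \<theta>)" by (simp add: e_mod_def \<theta>_def mult.assoc)
      ultimately have "e_mod p (int h) = - 1" by (simp add: complex_eq_iff)
      moreover have "e_mod p (int h) ^ p = 1" using e_mod_multiple[OF p0] by (simp add: e_mod_power)
      ultimately show False using odd by simp
    qed
    ultimately show ?thesis by (simp add: t_def tan_def \<theta>_def)
  qed
  have nd: "\<not> int p dvd int k" if "k \<in> {1..<p}" for k
    using that zdvd_not_zless[of "int k" "int p"] by auto
  have Kw: "K h k \<le> w" if "h \<in> {1..<p}" "k \<in> {1..<p}" for h k
    unfolding K_def w_def by (rule Weil_bound_kloosterman_sum(2)[OF p(1) odd nd nd]) (use that in auto)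
  have "norm (parity_correlation p)
      \<le> (1 / real p)\<^sup>2 * (\<Sum>h<p. \<Sum>k<p. t h * t k * K h k)"
  proof -
    have "norm (\<Sum>h<p. \<Sum>k<p. parity_coeff p (int h) * parity_coeff p (int k) * kloosterman_sum p (int h) (int k))
        \<le> (\<Sum>h<p. \<Sum>k<p. t h * t k * K h k)"
      by (intro order.trans[OF norm_sum] sum_mono)
         (simp add: norm_mult norm_parity_coeff[OF odd] t_def K_def)
    hence "(1 / real p)\<^sup>2 * norm (\<Sum>h<p. \<Sum>k<p. parity_coeff p (int h) * parity_coeff p (int k) * kloosterman_sum p (int h) (int k))
        \<le> (1 / real p)\<^sup>2 * (\<Sum>h<p. \<Sum>k<p. t h * t k * K h k)"
      by (intro mult_left_mono) auto
    thus ?thesis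
      unfolding parity_correlation_eq_kloosterman[OF p0 p(1)]
      by (simp add: norm_mult norm_power norm_divide)
  qed
  also have "(\<Sum>h<p. \<Sum>k<p. t h * t k * K h k) = (\<Sum>(h, k)\<in>P. t h * t k * K h k)"
  proof -
    have "(\<Sum>h<p. \<Sum>k<p. t h * t k * K h k) = (\<Sum>(h, k)\<in>{..<p} \<times> {..<p}. t h * t k * K h k)"
      by (rule sum.cartesian_product)
    also have "\<dots> = (\<Sum>(h, k)\<in>P. t h * t k * K h k)"
      unfolding P_def using t0 by (intro sum.mono_neutral_right) (auto simp: Suc_le_eq intro!: gr0I)
    finally show ?thesis .
  qed
  also have "(1 / real p)\<^sup>2 * (\<Sum>(h, k)\<in>P. t h * t k * K h k)
      < (1 / real p)\<^sup>2 * (\<Sum>(h, k)\<in>P. t h * t k * w)"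
  proof (rule mult_strict_left_mono)
    obtain k where k: "k \<in> {1..<p}" "K 1 k < w"
      using exists_small_kloosterman_sum[OF p(1) odd] by (auto simp: K_def w_def)
    have one: "1 \<in> {1..<p}" using p by simp
    show "(\<Sum>(h, k)\<in>P. t h * t k * K h k) < (\<Sum>(h, k)\<in>P. t h * t k * w)"
    proof (rule sum_strict_mono_ex1)
      show "finite P" by (simp add: P_def)
      show "\<forall>x\<in>P. (case x of (h, k) \<Rightarrow> t h * t k * K h k) \<le> (case x of (h, k) \<Rightarrow> t h * t k * w)"
        using Kw tpos by (auto simp: P_def intro!: mult_left_mono mult_nonneg_nonneg less_imp_le)
      show "\<exists>x\<in>P. (case x of (h, k) \<Rightarrow> t h * t k * K h k) < (case x of (h, k) \<Rightarrow> t h * t k * w)"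
        using k one tpos[OF one] tpos[OF k(1)] by (intro bexI[of _ "(1, k)"]) (auto simp: P_def)
    qed
  qed (use p0 in simp)
  also have "(\<Sum>(h, k)\<in>P. t h * t k * w) = (\<Sum>h\<in>{1..<p}. t h)\<^sup>2 * w"
  proof -
    have "(\<Sum>(h, k)\<in>P. t h * t k * w) = (\<Sum>h\<in>{1..<p}. \<Sum>k\<in>{1..<p}. t h * t k * w)"
      unfolding P_def by (rule sum.cartesian_product [symmetric])
    also have "\<dots> = (\<Sum>h\<in>{1..<p}. \<Sum>k\<in>{1..<p}. t h * t k) * w"
      by (simp only: sum_distrib_right)
    finally show ?thesis by (simp only: power2_eq_square sum_product)
  qed
  also have "(\<Sum>h\<in>{1..<p}. t h) = 2 * A"
    unfolding t_def A_def by (rule sum_abs_tan[OF odd])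
  finally have "norm (parity_correlation p) < (1 / real p)\<^sup>2 * ((2 * A)\<^sup>2 * w)" .
  also have "norm (parity_correlation p) = 2 * \<bar>real (lehmer_count p) - (real p - 1) / 2\<bar>"
    unfolding parity_correlation_eq_lehmer[OF p(1)] norm_of_real by (simp add: abs_if field_simps)
  finally show ?thesis by (simp add: w_def power_divide)
qed

section \<open>The tangent sum\<close>

lemma two_mult_le_ln_diff:
  fixes z :: real
  assumes "0 \<le> z" "z < 1"
  shows "2 * z \<le> ln (1 + z) - ln (1 - z)"
proof -
  have "(\<lambda>t. ln (1 + t) - ln (1 - t) - 2 * t) 0 \<le> (\<lambda>t. ln (1 + t) - ln (1 - t) - 2 * t) z"
  proof (rule DERIV_nonneg_imp_nondecreasing[OF assms(1)])
    fix t :: real assume t: "0 \<le> t" "t \<le> z"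
    have "((\<lambda>t. ln (1 + t) - ln (1 - t) - 2 * t) has_real_derivative 1 / (1 + t) + 1 / (1 - t) - 2) (at t)"
      using t assms by (auto intro!: derivative_eq_intros)
    moreover have "1 / (1 + t) + 1 / (1 - t) - 2 \<ge> 0"
    proof -
      have pos: "(1 + t) * (1 - t) > 0" using t assms by simp
      have "(1 + t) * (1 - t) \<le> 1" by (simp add: algebra_simps)
      hence "2 \<le> 2 / ((1 + t) * (1 - t))" using pos by (simp add: pos_le_divide_eq)
      also have "\<dots> = 1 / (1 + t) + 1 / (1 - t)" using t assms by (simp add: add_frac_eq)
      finally show ?thesis by simp
    qed
    ultimately show "\<exists>y. ((\<lambda>t. ln (1 + t) - ln (1 - t) - 2 * t) has_real_derivative y) (at t) \<and> 0 \<le> y"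
      by blast
  qed
  thus ?thesis by simp
qed

lemma le_tan:
  assumes "0 \<le> x" "x < pi / 2"
  shows "x \<le> tan x"
proof -
  have "arctan (tan x) \<le> tan x"
    using arctan_le_self[of "tan x"] assms tan_pos_pi2_le[of x] by simp
  thus ?thesis using assms arctan_tan[of x] by simp
qed

text \<open>
Midpoint estimate for the integral of the convex function \<open>tan\<close> over \<open>[\<theta> - \<delta>, \<theta> + \<delta>]\<close>, obtained
without integration: with \<open>z = tan \<theta> tan \<delta>\<close> the quotient of the cosines is \<open>(1 + z)/(1 - z)\<close>.
\<close>
lemma tan_le_ln_cos_quotient:
  assumes "0 < \<delta>" "0 \<le> \<theta>" "\<delta> + \<theta> < pi / 2"
  shows "2 * \<delta> * tan \<theta> \<le> ln (cos (\<theta> - \<delta>)) - ln (cos (\<theta> + \<delta>))"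
proof -
  define z where "z = tan \<theta> * tan \<delta>"
  have cp: "cos \<theta> > 0" "cos \<delta> > 0" "cos (\<theta> + \<delta>) > 0"
    using assms by (auto intro!: cos_gt_zero_pi)
  have t0: "tan \<theta> \<ge> 0" using assms tan_pos_pi2_le[of \<theta>] by simp
  have td: "\<delta> \<le> tan \<delta>" using assms by (intro le_tan) auto
  have plus: "cos (\<theta> + \<delta>) = cos \<theta> * cos \<delta> * (1 - z)"
    and minus: "cos (\<theta> - \<delta>) = cos \<theta> * cos \<delta> * (1 + z)"
    using cp by (simp_all add: z_def tan_def cos_add cos_diff algebra_simps)
  have z0: "0 \<le> z" using t0 td assms by (simp add: z_def)
  have "cos \<theta> * cos \<delta> > 0" using cp by simp
  hence z1: "z < 1" using cp(3) zero_less_mult_pos[of "cos \<theta> * cos \<delta>" "1 - z"] unfolding plus by simp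
  have "2 * \<delta> * tan \<theta> \<le> 2 * z"
    using mult_left_mono[OF td t0] by (simp add: z_def mult.commute)
  also have "\<dots> \<le> ln (1 + z) - ln (1 - z)" by (rule two_mult_le_ln_diff[OF z0 z1])
  also have "\<dots> = ln (cos (\<theta> - \<delta>)) - ln (cos (\<theta> + \<delta>))"
    unfolding plus minus using cp z0 z1 by (simp add: ln_mult)
  finally show ?thesis .
qed

text \<open>
The nodes \<open>\<pi>j/p\<close> are the midpoints of adjacent intervals of length \<open>\<pi>/p\<close>, so the bounds of the
previous lemma telescope. The last node is excluded, since its interval ends at \<open>\<pi>/2\<close> where the
cosine vanishes; there the tangent is estimated by \<open>cot x \<le> 1/x\<close>, which accounts for the \<open>2\<close>.
\<close>
lemma tan_sum_le:
  fixes p :: nat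
  assumes "odd p" "p > 3"
  shows "(\<Sum>j = 1..(p - 1) div 2. tan (pi * real j / real p))
    \<le> real p / pi * (2 - ln (sin (pi / real p)))"
proof -
  obtain m where m: "p = 2 * m + 3" "m \<ge> 1"
  proof -
    obtain k where "p = 2 * k + 1" using assms(1) by (elim oddE)
    thus ?thesis using assms(2) by (intro that[of "k - 1"]) auto
  qed
  define \<delta> where "\<delta> = pi / (2 * real p)"
  have pp: "real p > 0" using assms by simp
  have \<delta>: "\<delta> > 0" using pp by (simp add: \<delta>_def)
  have half: "real p * \<delta> = pi / 2" using pp by (simp add: \<delta>_def)
  have th: "pi * real j / real p = real (2 * j) * \<delta>" for j using pp by (simp add: \<delta>_def)
  define c where "c = (\<lambda>j. ln (cos (real (2 * j + 1) * \<delta>)))"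
  have lt: "real k * \<delta> < pi / 2" if "k < p" for k
    using that \<delta> half by (metis mult_strict_right_mono of_nat_less_iff)
  have step: "2 * \<delta> * tan (real (2 * j) * \<delta>) \<le> c (j - 1) - c j" if "j \<in> {1..m}" for j
  proof -
    have "2 * \<delta> * tan (real (2 * j) * \<delta>) 
      \<le> ln (cos (real (2 * j) * \<delta> - \<delta>)) - ln (cos (real (2 * j) * \<delta> + \<delta>))"
      using \<delta> lt[of "2 * j + 1"] that m by (intro tan_le_ln_cos_quotient) (auto simp: algebra_simps)
    moreover have "real (2 * j) * \<delta> - \<delta> = real (2 * (j - 1) + 1) * \<delta>"
      using that by (simp add: algebra_simps of_nat_diff)
    moreover have "real (2 * j) * \<delta> + \<delta> = real (2 * j + 1) * \<delta>" by (simp add: algebra_simps)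
    ultimately show ?thesis by (simp only: c_def)
  qed
  have tele: "(\<Sum>j=1..n. c (j - 1) - c j) = c 0 - c n" for n
    by (induction n) auto
  have "2 * \<delta> * (\<Sum>j=1..m. tan (real (2 * j) * \<delta>)) \<le> (\<Sum>j=1..m. c (j - 1) - c j)"
    unfolding sum_distrib_left by (rule sum_mono[OF step])
  also have "\<dots> = c 0 - c m" by (rule tele)
  also have "c 0 \<le> 0"
  proof -
    have "cos \<delta> > 0" using \<delta> lt[of 1] assms by (intro cos_gt_zero_pi) auto
    thus ?thesis by (simp add: c_def)
  qed
  also have "c m = ln (sin (pi / real p))"
  proof -
    have eq: "real (2 * m + 1) = real p - 2" using m by simp
    have "real (2 * m + 1) * \<delta> = pi / 2 - pi / real p"
      unfolding eq using pp by (simp add: \<delta>_def field_simps)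
    thus ?thesis by (simp add: c_def cos_diff)
  qed
  finally have 1: "2 * \<delta> * (\<Sum>j=1..m. tan (real (2 * j) * \<delta>)) \<le> - ln (sin (pi / real p))" by simp
  have 2: "2 * \<delta> * tan (real (2 * (m + 1)) * \<delta>) \<le> 2"
  proof -
    have eq: "real (2 * (m + 1)) = real p - 1" using m by simp
    have "real (2 * (m + 1)) * \<delta> = pi / 2 - \<delta>"
      unfolding eq left_diff_distrib half by simp
    hence cot: "tan (real (2 * (m + 1)) * \<delta>) = inverse (tan \<delta>)"
      by (simp add: tan_def cos_diff sin_diff)
    have "\<delta> \<le> tan \<delta>" using \<delta> lt[of 1] assms by (intro le_tan) auto
    thus ?thesis unfolding cot using \<delta> by (simp add: field_simps)
  qed
  have dp: "(p - 1) div 2 = Suc m" using m by simp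
  have "2 * \<delta> * (\<Sum>j = 1..(p - 1) div 2. tan (pi * real j / real p)) \<le> 2 - ln (sin (pi / real p))"
    using 1 2 unfolding th dp by (simp add: distrib_left)
  hence "(\<Sum>j = 1..(p - 1) div 2. tan (pi * real j / real p)) \<le> (2 - ln (sin (pi / real p))) / (2 * \<delta>)"
    using \<delta> by (simp add: field_simps)
  also have "\<dots> = real p / pi * (2 - ln (sin (pi / real p)))"
    using pp by (simp add: \<delta>_def field_simps)
  finally show ?thesis .
qed

text \<open>
Lower bounds for logarithms from rational arithmetic, using \<open>e < 2.72\<close>.
\<close>
lemma le_mult_ln:
  fixes x :: real
  assumes "x > 0" "(272 / 100) ^ m \<le> x ^ n"
  shows "real m \<le> real n * ln x"
proof -
  have "exp (real m) = exp 1 ^ m" by (simp flip: exp_of_nat_mult)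
  also have "\<dots> \<le> (272 / 100) ^ m" using e_less_272 by (intro power_mono) auto
  also have "\<dots> \<le> x ^ n" by fact
  finally have "ln (exp (real m)) \<le> ln (x ^ n)" using assms(1) by (subst ln_le_cancel_iff) auto
  thus ?thesis using assms(1) by (simp add: ln_realpow)
qed

lemma T_nonneg: "odd p \<Longrightarrow> p > 3 \<Longrightarrow> T p \<ge> 0"
proof -
  assume p: "odd p" "p > 3"
  have "tan (pi * real j / real p) \<ge> 0" if "j \<in> {1..(p - 1) div 2}" for j
  proof -
    have "2 * j < p" using that p by auto
    hence "pi * (2 * real j) < pi * real p" by (intro mult_strict_left_mono) auto
    thus ?thesis using p by (intro tan_pos_pi2_le) (auto simp: field_simps)
  qed
  thus ?thesis unfolding T_def using p by (auto intro!: divide_nonneg_nonneg sum_nonneg)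
qed

text \<open>
Since \<open>p sin (\<pi>/p)\<close> is close to \<open>\<pi>\<close>, and at least \<open>3.1\<close>, the estimate of the tangent sum becomes
\<open>T\<^sub>p \<le> (2/\<pi>) (1 + 0.88/ln p)\<close>; here \<open>0.88 = 2 - 1.12\<close> and \<open>ln 3.1 \<ge> 1.12\<close>. At \<open>ln p = 8\<close> this is
\<open>2.22/\<pi>\<close>, whose square is below \<open>1/2\<close>.
\<close>
lemma T_square_less_half:
  assumes p: "odd p" "p > 3" and big: "ln (real p) \<ge> 8"
  shows "(T p)\<^sup>2 < 1 / 2"
proof -
  define L where "L = ln (real p)"
  have L: "L \<ge> 8" using big by (simp add: L_def)
  have pp: "real p > 0" using p by simp
  have p100: "real p \<ge> 100"
  proof -
    have "(2 :: real) ^ 8 \<le> exp 1 ^ 8" using exp_ge_add_one_self[of 1] by (intro power_mono) auto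
    also have "\<dots> = exp (8 :: real)" by (simp flip: exp_of_nat_mult)
    also have "\<dots> \<le> exp L" using L by simp
    also have "\<dots> = real p" using pp by (simp add: L_def)
    finally show ?thesis by simp
  qed
  define x where "x = pi / real p"
  have x: "0 < x" "x \<le> 4 / 100" 
    using pp p100 pi_less_4 by (auto simp: x_def field_simps intro!: order.trans[OF less_imp_le[OF pi_less_4]])
  have "\<bar>sin x - (\<Sum>m<3. sin_coeff m * x ^ m)\<bar> \<le> inverse (fact 3) * \<bar>x\<bar> ^ 3"
    by (rule Maclaurin_sin_bound)
  hence "sin x \<ge> x - x ^ 3 / 6"
    using x by (simp add: sin_coeff_def eval_nat_numeral fact_reduce abs_if split: if_splits)
  also have "x - x ^ 3 / 6 = x * (1 - x\<^sup>2 / 6)" by (simp add: algebra_simps eval_nat_numeral)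
  finally have "sin x \<ge> x * (1 - x\<^sup>2 / 6)" .
  moreover have "x\<^sup>2 \<le> (4 / 100)\<^sup>2" using x by (intro power_mono) auto
  hence "1 - x\<^sup>2 / 6 \<ge> 999 / 1000" by (simp add: power2_eq_square)
  hence "x * (1 - x\<^sup>2 / 6) \<ge> x * (999 / 1000)" using x by (intro mult_left_mono) auto
  ultimately have "sin x \<ge> x * (999 / 1000)" by linarith
  hence "real p * sin x \<ge> pi * (999 / 1000)" using pp by (simp add: x_def field_simps)
  hence ps: "real p * sin x \<ge> 31 / 10" using pi_approx(1) by simp
  have s0: "sin x > 0" using ps pp zero_less_mult_pos[of "real p" "sin x"] by simp
  have "real 28 \<le> real 25 * ln (31 / 10)"
    by (rule le_mult_ln) (simp_all add: power_divide divide_simps)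
  also have "\<dots> \<le> real 25 * ln (real p * sin x)"
    using ps by (intro mult_left_mono) (simp_all add: ln_le_cancel_iff)
  also have "ln (real p * sin x) = L + ln (sin x)" using s0 pp by (simp add: ln_mult L_def)
  finally have ls: "2 - ln (sin x) \<le> L + 88 / 100" by simp
  have "T p = 2 / (real p * L) * (\<Sum>j = 1..(p - 1) div 2. tan (pi * real j / real p))"
    by (simp add: T_def L_def)
  also have "\<dots> \<le> 2 / (real p * L) * (real p / pi * (2 - ln (sin x)))"
    unfolding x_def using tan_sum_le[OF p] L pp by (intro mult_left_mono) auto
  also have "\<dots> = 2 / (pi * L) * (2 - ln (sin x))" using pp L by (simp add: divide_simps)
  also have "\<dots> \<le> 2 / (pi * L) * (L + 88 / 100)"
    using ls L by (intro mult_left_mono) auto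
  also have "\<dots> = 2 / pi * ((L + 88 / 100) / L)" by simp
  also have "(L + 88 / 100) / L = 1 + 88 / 100 / L" using L by (simp only: add_divide_distrib) simp
  also have "2 / pi * (1 + 88 / 100 / L) \<le> 2 / pi * (1 + 88 / 100 / 8)"
    using L by (intro mult_left_mono add_left_mono divide_left_mono) auto
  also have "\<dots> = 222 / 100 / pi" by (simp add: field_simps)
  also have "\<dots> \<le> 222 / 100 / (3.1415)"
    using pi_approx(1) by (intro divide_left_mono) auto
  finally have "T p \<le> 222 / 100 / (3.1415)" .
  hence "(T p)\<^sup>2 \<le> (222 / 100 / (3.1415))\<^sup>2" using T_nonneg[OF p] by (intro power_mono) auto
  also have "\<dots> < 1 / 2" by (simp add: power2_eq_square)
  finally show ?thesis .
qed

text \<open>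
By concavity it is enough to check the end points, where \<open>ln 1.6 \<ge> 0.4\<close> and \<open>ln 8 \<ge> 2\<close>.
\<close>
lemma le_four_ln:
  fixes l :: real
  assumes "16 / 10 \<le> l" "l \<le> 8"
  shows "l \<le> 4 * ln l"
proof -
  define t where "t = (l - 16 / 10) / (64 / 10)"
  have t: "0 \<le> t" "t \<le> 1" using assms by (auto simp: t_def)
  have l: "l = (1 - t) * (16 / 10) + t * 8" by (simp add: t_def field_simps)
  have "real 2 \<le> real 5 * ln (16 / 10)" by (rule le_mult_ln) (simp_all add: power_divide)
  hence a: "ln (16 / 10 :: real) \<ge> 4 / 10" by simp
  have "ln (8 :: real) = 3 * ln 2" using ln_realpow[of 2 3] by simp
  hence b: "ln (8 :: real) \<ge> 2" using ln2_ge_two_thirds by simp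
  have "l / 4 = (1 - t) * (4 / 10) + t * 2" unfolding l by (simp add: algebra_simps)
  also have "\<dots> \<le> (1 - t) * ln (16 / 10) + t * ln 8"
    using t a b by (intro add_mono mult_left_mono) auto
  also have "\<dots> \<le> ln l"
    unfolding l using concave_onD[OF ln_concave t(1,2), of "16 / 10" 8] by simp
  finally show ?thesis by simp
qed

text \<open>
With \<open>l = ln x\<close> the claim is \<open>exp (l/2) \<le> l\<^sup>2\<close>, that is \<open>l \<le> 4 ln l\<close>. The lower end \<open>ln 5 \<ge> 1.6\<close> of the
range is where \<open>x \<ge> 5\<close> is used.
\<close>
lemma less_sqrt_mult_ln_square:
  fixes x :: real
  assumes "x \<ge> 5" "ln x < 8"
  shows "x \<le> sqrt x * (ln x)\<^sup>2"
proof -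
  have "real 8 \<le> real 5 * ln 5" by (rule le_mult_ln) (simp_all add: power_divide divide_simps)
  hence "ln (5 :: real) \<ge> 16 / 10" by simp
  moreover have "ln 5 \<le> ln x" using assms by simp
  ultimately have l: "ln x \<ge> 16 / 10" by linarith
  have "exp (ln x / 2) ^ 2 = x"
    using exp_double[of "ln x / 2"] assms by simp
  hence "sqrt x = exp (ln x / 2)" by (intro real_sqrt_unique) auto
  also have "\<dots> \<le> exp (2 * ln (ln x))" using le_four_ln[OF l] assms by simp
  also have "\<dots> = exp (ln (ln x)) ^ 2" by (simp add: exp_double)
  also have "\<dots> = (ln x)\<^sup>2" using l by simp
  finally have "sqrt x * sqrt x \<le> sqrt x * (ln x)\<^sup>2" using assms by (intro mult_left_mono) auto
  thus ?thesis using assms by simp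
qed

section \<open>The number of Lehmer numbers\<close>

theorem theorem3:
  fixes p :: nat
  assumes "prime p" and "p > 3"
  shows "\<bar>real (lehmer_count p) - (real p - 1) / 2\<bar> < (T p)\<^sup>2 * sqrt (real p) * (ln (real p))\<^sup>2
       \<and> \<bar>real (lehmer_count p) - (real p - 1) / 2\<bar> < 1 / 2 * sqrt (real p) * (ln (real p))\<^sup>2"
proof -
  have odd: "odd p" using assms prime_odd_nat by auto
  define L where "L = ln (real p)"
  have L: "L > 0" using assms by (simp add: L_def)
  have pos: "sqrt (real p) * L\<^sup>2 > 0" using L assms by simp
  let ?\<Delta> = "\<bar>real (lehmer_count p) - (real p - 1) / 2\<bar>"
  have "2 * (\<Sum>j = 1..(p - 1) div 2. tan (pi * real j / real p)) / real p = T p * L"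
    using L assms by (simp add: T_def L_def)
  hence 1: "?\<Delta> < (T p)\<^sup>2 * sqrt (real p) * L\<^sup>2"
    using lehmer_count_bound[OF assms] by (simp add: power_mult_distrib mult_ac)
  moreover have "?\<Delta> < 1 / 2 * sqrt (real p) * L\<^sup>2"
  proof (cases "L \<ge> 8")
    case True
    hence "(T p)\<^sup>2 * (sqrt (real p) * L\<^sup>2) \<le> 1 / 2 * (sqrt (real p) * L\<^sup>2)"
      using T_square_less_half[OF odd assms(2)] pos by (intro mult_right_mono) (auto simp: L_def)
    thus ?thesis using 1 by (simp add: mult.assoc)
  next
    case False
    have "finite {1..int p - 1}" "{a. lehmer_number p a} \<subseteq> {1..int p - 1}"
      by (auto simp: lehmer_number_def)
    hence "lehmer_count p \<le> card {1..int p - 1}" unfolding lehmer_count_def by (rule card_mono)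
    hence "real (lehmer_count p) \<le> real p - 1" using assms by (simp add: of_nat_diff nat_diff_distrib)
    hence "?\<Delta> \<le> (real p - 1) / 2" by (auto simp: abs_if)
    also have "\<dots> < real p / 2" by simp
    also have "p \<noteq> 4" using odd by auto
    hence "real p \<le> sqrt (real p) * L\<^sup>2"
      unfolding L_def using assms False by (intro less_sqrt_mult_ln_square) (auto simp: L_def)
    finally show ?thesis by simp
  qed
  ultimately show ?thesis by (simp add: L_def)
qed

end
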